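(* Let $G$ be a planar graph with girth $g(G)=g$. Then: (i) $g\ge7$ implies $\chi_{\rm pcf}(G)\le6$; (ii) $g\ge10$ implies $\chi_{\rm pcf}(G)\le5$; (iii) $g\ge24$ implies $\chi_{\rm pcf}(G)\le4$.
   Context: All graphs are simple, finite and undirected. A vertex coloring of a graph is proper if adjacent vertices get distinct colors. It is conflict-free (with respect to open neighborhoods) if for every non-isolated vertex $x$ there is a color that appears exactly once on the open neighborhood $N(x)$. A PCF $k$-coloring is a vertex coloring with at most $k$ colors that is both proper and conflict-free. The PCF chromatic number $\chi_{\rm pcf}(G)$ is the minimum $k$ for which $G$ admits a PCF $k$-coloring. The girth of $G$ is the length of a shortest cycle in $G$ (infinite if $G$ has no cycle). *)

theory Defs
  imports "HOL-Analysis.Analysis" "Graph_Theory.Pair_Digraph"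
begin

text \<open>
  A finite simple undirected graph is a \<^locale>\<open>pair_graph\<close>: a finite, symmetric, irreflexive
  set of arcs on a finite vertex set. An undirected edge is thus a pair of opposite arcs
  \<open>(u, v)\<close>, \<open>(v, u)\<close>, and is identified below with the set \<open>{u, v}\<close>.
\<close>

definition neighborhood :: "'a pair_pre_digraph \<Rightarrow> 'a \<Rightarrow> 'a set" where
  "neighborhood G x = {y. (x, y) \<in> parcs G}"


subsection \<open>Colorings\<close>

definition proper_coloring :: "'a pair_pre_digraph \<Rightarrow> ('a \<Rightarrow> nat) \<Rightarrow> bool" where
  "proper_coloring G c \<longleftrightarrow> (\<forall>(u, v) \<in> parcs G. c u \<noteq> c v)"

definition conflict_free_coloring :: "'a pair_pre_digraph \<Rightarrow> ('a \<Rightarrow> nat) \<Rightarrow> bool" where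
  "conflict_free_coloring G c \<longleftrightarrow>
     (\<forall>x \<in> pverts G. neighborhood G x \<noteq> {} \<longrightarrow>
        (\<exists>i. card {y \<in> neighborhood G x. c y = i} = 1))"

definition pcf_coloring :: "'a pair_pre_digraph \<Rightarrow> nat \<Rightarrow> ('a \<Rightarrow> nat) \<Rightarrow> bool" where
  "pcf_coloring G k c \<longleftrightarrow>
     card (c ` pverts G) \<le> k \<and> proper_coloring G c \<and> conflict_free_coloring G c"

text \<open>
  For a \<^locale>\<open>pair_graph\<close> the minimum is attained, since an injective coloring is
  always proper and conflict-free; see \<open>ex_pcf_coloring\<close>.
\<close>

definition pcf_chromatic_number :: "'a pair_pre_digraph \<Rightarrow> nat" where
  "pcf_chromatic_number G = (LEAST k. \<exists>c. pcf_coloring G k c)"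

lemma ex_pcf_coloring:
  assumes "pair_graph G"
  shows "\<exists>c. pcf_coloring G (card (pverts G)) c"
proof -
  interpret pair_graph G by fact
  obtain c :: "'a \<Rightarrow> nat" where inj: "inj_on c (pverts G)"
    using finite_imp_inj_to_nat_seg[OF pair_finite_verts] by blast
  have "proper_coloring G c"
    unfolding proper_coloring_def
    using inj pair_no_loops by (fastforce dest: in_arcsD1 in_arcsD2 inj_onD)
  moreover have "conflict_free_coloring G c"
    unfolding conflict_free_coloring_def
  proof (intro ballI impI)
    fix x assume "neighborhood G x \<noteq> {}"
    then obtain y where y: "(x, y) \<in> parcs G" by (auto simp: neighborhood_def)
    then have "{z \<in> neighborhood G x. c z = c y} = {y}"
      using inj by (auto simp: neighborhood_def dest: in_arcsD2 inj_onD)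
    then show "\<exists>i. card {z \<in> neighborhood G x. c z = i} = 1"
      by (intro exI[of _ "c y"]) simp
  qed
  ultimately show ?thesis
    unfolding pcf_coloring_def using pair_finite_verts card_image_le by blast
qed


subsection \<open>Girth\<close>

text \<open>
  As directed cycles of the symmetric digraph, the traversals \<open>[(u, v), (v, u)]\<close> of a single
  edge satisfy \<^const>\<open>pre_digraph.cycle\<close>; the bound on the length excludes them.
  Without cycles, the infimum is that of the empty set in \<^typ>\<open>enat\<close>, i.e. infinity.
\<close>

definition girth :: "'a pair_pre_digraph \<Rightarrow> enat" where
  "girth G = (INF p \<in> {p. pre_digraph.cycle (with_proj G) p \<and> 3 \<le> length p}. enat (length p))"


subsection \<open>Planarity\<close>

text \<open>
  The plane is \<^typ>\<open>complex\<close>. Vertices are drawn as distinct points and the edge \<open>{u, v}\<close> as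
  an arc \<open>\<gamma> {u, v}\<close> (an injective continuous path, in either direction) joining its two ends,
  such that the interior of an edge meets no vertex and no other edge.
\<close>

definition plane_drawing ::
    "'a pair_pre_digraph \<Rightarrow> ('a \<Rightarrow> complex) \<Rightarrow> ('a set \<Rightarrow> real \<Rightarrow> complex) \<Rightarrow> bool" where
  "plane_drawing G pos \<gamma> \<longleftrightarrow>
     inj_on pos (pverts G) \<and>
     (\<forall>(u, v) \<in> parcs G.
        arc (\<gamma> {u, v}) \<and>
        {pathstart (\<gamma> {u, v}), pathfinish (\<gamma> {u, v})} = {pos u, pos v} \<and>
        (path_image (\<gamma> {u, v}) - {pos u, pos v}) \<inter> pos ` pverts G = {} \<and>
        (\<forall>(x, y) \<in> parcs G. {x, y} \<noteq> {u, v} \<longrightarrow>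
           (path_image (\<gamma> {u, v}) - {pos u, pos v}) \<inter> path_image (\<gamma> {x, y}) = {}))"

definition planar :: "'a pair_pre_digraph \<Rightarrow> bool" where
  "planar G \<longleftrightarrow> (\<exists>pos \<gamma>. plane_drawing G pos \<gamma>)"

end

theory Submission
  imports Defs
begin

text \<open>
  A plane graph in which every cycle has length at least g satisfies (g - 2) e < g n, because
  2-connected pieces grow from a cycle by adding ears, and each ear splits one face, bounded by a
  cycle, into two such faces (the theta curve lemma, which follows from the Jordan curve theorem and
  Janiszewski's theorem); pieces meeting in at most one vertex are then glued together. So the
  average degree of every subgraph is below 14/5, 5/2 and 24/11 in the three cases. On the other
  hand, an induced subgraph that is minimal without a coloring avoids a few configurations of
  2-vertices, since a coloring of the rest extends to them: each new vertex only has to avoid, for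
  every neighbor outside, the color of that neighbor and one color that is unique around it.
  Discharging then gives the reverse inequality for its average degree.
\<close>

subsection \<open>Theta curves\<close>

text \<open>Counting edges by faces needs every face to be bounded by a cycle, which fails in graphs
  with bridges or cut vertices; this is why faces are followed through ear additions only. The bound
  is kept as g d + 2 g \<le> 2 d + 2 g n for d darts and n vertices: the slack 2 g on the left pays
  for exactly one vertex shared by two glued pieces. On the coloring side, conflict-freeness is not
  inherited by subgraphs, and coloring a removed vertex can spoil the only unique color around an
  old one. Hence one unique color per old vertex is fixed in advance. A new vertex may have to avoid
  one more color, so that two neighbors of another new vertex differ; counting all forbidden colors
  gives the palettes 6 and 5. With 4 colors such greedy choices only remove leaves, and a thread of
  four 2-vertices is colored by an explicit pattern. The degrees 14/5, 5/2 and 24/11 are 2 g / (g -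
  2) for g = 7, 10, 24. Discharging reaches them without strict inequality, so the contradiction
  rests on the strictness of the planar bound.\<close>

lemma Jordan_components:
  fixes c1 c2 :: "real \<Rightarrow> complex"
  assumes arcs: "arc c1" "arc c2"
    and ends: "pathstart c1 = a" "pathfinish c1 = b" "pathstart c2 = a" "pathfinish c2 = b"
    and int: "path_image c1 \<inter> path_image c2 = {a, b}"
  obtains I U where "components (- (path_image c1 \<union> path_image c2)) = {I, U}" "I \<noteq> U" "I \<inter> U = {}"
    "frontier I = path_image c1 \<union> path_image c2" "frontier U = path_image c1 \<union> path_image c2"
proof -
  let ?c = "c1 +++ reversepath c2"
  have simple: "simple_path ?c"
    by (rule simple_path_join_loop) (use assms in \<open>auto simp: arc_reversepath\<close>)
  have loop: "pathfinish ?c = pathstart ?c"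
    using ends by simp
  have img: "path_image ?c = path_image c1 \<union> path_image c2"
    using ends by (simp add: path_image_join)
  obtain I U where IU: "I \<noteq> {}" "open I" "connected I" "U \<noteq> {}" "open U" "connected U"
      "bounded I" "\<not> bounded U" "I \<inter> U = {}" "I \<union> U = - path_image ?c"
      "frontier I = path_image ?c" "frontier U = path_image ?c"
    using Jordan_curve[OF simple loop] by blast
  have "components (- path_image ?c) = {I, U}"
    by (rule components_open_unique) (use IU in \<open>auto simp: pairwise_def disjnt_def\<close>)
  with IU img show ?thesis
    by (intro that[of I U]) auto
qed

text \<open>The frontier of I is the whole first Jordan curve, so c2 lies in the closure of I. The
  side D of the second curve that is away from I is open, so meeting c2 would force it to meet
  I.\<close>

lemma theta_side:
  fixes c1 c2 c3 :: "real \<Rightarrow> complex"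
  assumes arcs: "arc c1" "arc c2" "arc c3"
    and ends: "pathstart c1 = a" "pathfinish c1 = b" "pathstart c2 = a" "pathfinish c2 = b"
      "pathstart c3 = a" "pathfinish c3 = b"
    and int: "path_image c1 \<inter> path_image c2 = {a, b}" "path_image c1 \<inter> path_image c3 = {a, b}"
      "path_image c2 \<inter> path_image c3 = {a, b}"
    and I: "I \<in> components (- (path_image c1 \<union> path_image c2))" "I \<inter> path_image c3 = {}"
  obtains B D where "components (- (path_image c1 \<union> path_image c3)) = {B, D}" "I \<subseteq> B" "B \<inter> D = {}"
    "D \<inter> path_image c2 = {}" "frontier D = path_image c1 \<union> path_image c3"
proof -
  obtain P Q where PQ: "components (- (path_image c1 \<union> path_image c3)) = {P, Q}" "P \<noteq> Q"
      "P \<inter> Q = {}" "frontier P = path_image c1 \<union> path_image c3"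
      "frontier Q = path_image c1 \<union> path_image c3"
    by (rule Jordan_components[OF arcs(1,3) ends(1,2,5,6) int(2)])
  have clo: "closed (path_image c1 \<union> path_image c3)"
    using arcs by (simp add: closed_Un closed_arc_image)
  have Iprop: "connected I" "I \<noteq> {}" "I \<subseteq> - (path_image c1 \<union> path_image c2)"
    using I(1) in_components_connected in_components_nonempty in_components_subset by blast+
  have "frontier I = path_image c1 \<union> path_image c2"
  proof -
    obtain P' Q' where "components (- (path_image c1 \<union> path_image c2)) = {P', Q'}"
      "frontier P' = path_image c1 \<union> path_image c2" "frontier Q' = path_image c1 \<union> path_image c2"
      by (rule Jordan_components[OF arcs(1,2) ends(1-4) int(1)])
    moreover from this(1) I(1) have "I = P' \<or> I = Q'" by blast
    ultimately show ?thesis by metis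
  qed
  then have c2I: "path_image c2 \<subseteq> closure I"
    by (auto simp: frontier_def)
  have Isub: "I \<subseteq> - (path_image c1 \<union> path_image c3)"
    using Iprop I(2) by blast
  have main: "D \<inter> path_image c2 = {}"
    if BD: "components (- (path_image c1 \<union> path_image c3)) = {B, D}" "I \<subseteq> B" "B \<inter> D = {}" for B D
  proof -
    have "open D"
      by (rule open_components[of "- (path_image c1 \<union> path_image c3)"])
        (use BD(1) clo in \<open>auto simp only: open_Compl insertI1 insertI2\<close>)
    show ?thesis
    proof (rule ccontr)
      assume "D \<inter> path_image c2 \<noteq> {}"
      then obtain x where "x \<in> D" "x \<in> closure I" using c2I by blast
      then have "D \<inter> I \<noteq> {}"
        using \<open>open D\<close> open_Int_closure_eq_empty by blast
      then show False using BD by blast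
    qed
  qed
  obtain R where "R \<in> components (- (path_image c1 \<union> path_image c3))" "I \<subseteq> R"
    using exists_component_superset[OF Isub _ Iprop(1)] Iprop Isub by blast
  then consider "I \<subseteq> P" | "I \<subseteq> Q" using PQ(1) by auto
  then show ?thesis
  proof cases
    case 1
    then show ?thesis using main[of P Q] PQ that[of P Q] by auto
  next
    case 2
    then show ?thesis using main[of Q P] PQ that[of Q P] by (auto simp: insert_commute)
  qed
qed

lemma arc_image_interior_nonempty:
  fixes c :: "real \<Rightarrow> 'a::real_normed_vector"
  assumes "arc c"
  obtains x where "x \<in> path_image c" "x \<noteq> pathstart c" "x \<noteq> pathfinish c"
proof
  have inj: "inj_on c {0..1}" using assms by (simp add: arc_def)
  show "c (1/2) \<in> path_image c" by (simp add: path_image_def)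
  show "c (1/2) \<noteq> pathstart c" "c (1/2) \<noteq> pathfinish c"
    using inj_on_eq_iff[OF inj, of "1/2" 0] inj_on_eq_iff[OF inj, of "1/2" 1]
    by (auto simp: pathstart_def pathfinish_def)
qed

text \<open>With I the other side of c1 and c2, the two pieces of D are the sides of the remaining
  two Jordan curves that avoid I.\<close>

lemma theta_split:
  fixes c1 c2 c3 :: "real \<Rightarrow> complex"
  assumes arcs: "arc c1" "arc c2" "arc c3"
    and ends: "pathstart c1 = a" "pathfinish c1 = b" "pathstart c2 = a" "pathfinish c2 = b"
      "pathstart c3 = a" "pathfinish c3 = b"
    and int: "path_image c1 \<inter> path_image c2 = {a, b}" "path_image c1 \<inter> path_image c3 = {a, b}"
      "path_image c2 \<inter> path_image c3 = {a, b}"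
    and D: "D \<in> components (- (path_image c1 \<union> path_image c2))" "path_image c3 - {a, b} \<subseteq> D"
  obtains D1 D2 where "D1 \<in> components (- (path_image c1 \<union> path_image c3))"
    "D2 \<in> components (- (path_image c2 \<union> path_image c3))"
    "D1 \<inter> D2 = {}" "D - path_image c3 = D1 \<union> D2"
proof -
  let ?J1 = "path_image c1 \<union> path_image c3" and ?J2 = "path_image c2 \<union> path_image c3"
    and ?J3 = "path_image c1 \<union> path_image c2"
  obtain I where I: "components (- ?J3) = {D, I}" "D \<inter> I = {}"
  proof -
    obtain P Q where "components (- ?J3) = {P, Q}" "P \<inter> Q = {}"
      by (rule Jordan_components[OF arcs(1,2) ends(1-4) int(1)])
    moreover from this(1) D(1) have "D = P \<or> D = Q" by blast
    ultimately show ?thesis using that[of P] that[of Q] by (metis insert_commute inf_commute)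
  qed
  have ab: "a \<in> path_image c1" "a \<in> path_image c2" "a \<in> path_image c3"
    "b \<in> path_image c1" "b \<in> path_image c2" "b \<in> path_image c3"
    using int by auto
  have DI: "D \<union> I = - ?J3"
    using I(1) Union_components[of "- ?J3"] by auto
  have I3: "I \<inter> path_image c3 = {}"
    using D(2) DI I(2) ab by blast
  have Icomp: "I \<in> components (- (path_image c1 \<union> path_image c2))"
    "I \<in> components (- (path_image c2 \<union> path_image c1))"
    using I(1) by (auto simp: Un_commute)
  obtain B1 D1 where 1: "components (- ?J1) = {B1, D1}" "I \<subseteq> B1" "B1 \<inter> D1 = {}"
      "D1 \<inter> path_image c2 = {}" "frontier D1 = ?J1"
    by (rule theta_side[OF arcs ends int Icomp(1) I3])
  obtain B2 D2 where 2: "components (- ?J2) = {B2, D2}" "I \<subseteq> B2" "B2 \<inter> D2 = {}"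
      "D2 \<inter> path_image c1 = {}" "frontier D2 = ?J2"
    by (rule theta_side[of c2 c1 c3 a b I]) (use arcs ends int Icomp(2) I3 in \<open>auto simp: Int_commute\<close>)
  have cover: "B1 \<union> D1 = - ?J1" "B2 \<union> D2 = - ?J2"
    using 1(1) 2(1) Union_components[of "- ?J1"] Union_components[of "- ?J2"] by auto
  have conn: "connected D1" "connected D2" "connected B1" "connected B2"
    using in_components_connected[of _ "- ?J1"] in_components_connected[of _ "- ?J2"]
    unfolding 1(1) 2(1) by simp_all
  have "I \<noteq> {}" using Icomp(1) in_components_nonempty by blast
  then obtain i where i: "i \<in> I" by blast
  have D1sub: "D1 \<subseteq> D"
    using 1(2-4) cover(1) DI by blast
  have D2sub: "D2 \<subseteq> D"
    using 2(2-4) cover(2) DI by blast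
  have D1_J: "D1 \<subseteq> - ?J2"
    using 1(4) cover(1) by blast
  have D2_J: "D2 \<subseteq> - ?J1"
    using 2(4) cover(2) by blast
  have disj: "D1 \<inter> D2 = {}"
  proof (rule ccontr)
    \<comment> \<open>Each piece avoids the curve of the other, so an overlap makes them equal by
      maximality of components. Their frontiers \<open>?J1\<close> and \<open>?J2\<close> would then
      agree, but an inner point of c1 lies on \<open>?J1\<close> only.\<close>
    assume ne: "D1 \<inter> D2 \<noteq> {}"
    have "D1 \<subseteq> D2"
      by (rule components_maximal[of D2 "- ?J2"]) (use 2(1) cover 1(4) conn ne D1sub D2sub D1_J D2_J in auto)
    moreover have "D2 \<subseteq> D1"
      by (rule components_maximal[of D1 "- ?J1"]) (use 1(1) cover 2(4) conn ne D1_J D2_J in auto)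
    ultimately have "?J1 = ?J2" using 1(5) 2(5) by simp
    moreover obtain x where "x \<in> path_image c1" "x \<noteq> a" "x \<noteq> b"
      using arc_image_interior_nonempty[OF arcs(1)] ends by metis
    ultimately show False using int by blast
  qed
  (* Such an x is separated from I neither by J1 nor by J2; as J1 and J2 meet in the connected
     set c3, Janiszewski's theorem applies to their union. *)
  have "x \<in> D1 \<union> D2" if x: "x \<in> D" "x \<notin> path_image c3" for x
  proof (rule ccontr)
    assume nx: "x \<notin> D1 \<union> D2"
    have "x \<notin> path_image c1 \<union> path_image c2 \<union> path_image c3" using x DI by blast
    then have x12: "x \<in> B1" "x \<in> B2" using nx cover by auto
    have "connected_component (- ?J1) x i"
      using x12(1) i 1(2) conn(3) cover(1) unfolding connected_component_def by blast
    moreover have "connected_component (- ?J2) x i"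
      using x12(2) i 2(2) conn(4) cover(2) unfolding connected_component_def by blast
    moreover have "?J1 \<inter> ?J2 = path_image c3" using int by blast
    then have "connected (?J1 \<inter> ?J2)" using connected_arc_image[OF arcs(3)] by simp
    moreover have "compact ?J1" "closed ?J2"
      using arcs by (simp_all add: compact_Un closed_Un compact_arc_image closed_arc_image)
    ultimately have cc: "connected_component (- (?J1 \<union> ?J2)) x i"
      by (blast intro: Janiszewski[of ?J1 ?J2 x i])
    have "connected_component (- ?J3) x i"
      by (rule connected_component_of_subset[OF cc]) auto
    then obtain T where "connected T" "T \<subseteq> - ?J3" "x \<in> T" "i \<in> T"
      unfolding connected_component_def by blast
    then have "T \<subseteq> D"
      by (intro components_maximal[OF D(1)]) (use x in auto)
    then show False using \<open>i \<in> T\<close> i I(2) by blast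
  qed
  then have "D - path_image c3 = D1 \<union> D2"
    using D1sub D2sub cover by auto
  then show ?thesis
    using that[of D1 D2] 1(1) 2(1) disj by simp
qed

text \<open>P meets U inside D only, so the other components survive. The new family is recognized
  as the components because its members are open, connected, nonempty, disjoint and have union U -
  P.\<close>

lemma components_split_component:
  fixes U :: "'a::real_normed_vector set"
  assumes "open U" "D \<in> components U" "D - P = D1 \<union> D2" "P \<inter> U \<subseteq> D"
    "open D1" "connected D1" "D1 \<noteq> {}" "open D2" "connected D2" "D2 \<noteq> {}" "D1 \<inter> D2 = {}"
  shows "components (U - P) = insert D1 (insert D2 (components U - {D}))"
proof (rule components_open_unique)
  have disj: "X \<inter> Y = {}" if "X \<in> components U" "Y \<in> components U" "X \<noteq> Y" for X Y
    using that components_nonoverlap by blast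
  show "pairwise disjnt (insert D1 (insert D2 (components U - {D})))"
    unfolding pairwise_insert
  proof (intro conjI)
    have "D1 \<subseteq> D" "D2 \<subseteq> D" using assms(3) by auto
    then show "\<forall>Y. Y \<in> insert D2 (components U - {D}) \<and> Y \<noteq> D1 \<longrightarrow> disjnt D1 Y \<and> disjnt Y D1"
      "\<forall>Y. Y \<in> components U - {D} \<and> Y \<noteq> D2 \<longrightarrow> disjnt D2 Y \<and> disjnt Y D2"
      using disj[OF assms(2)] assms(11) unfolding disjnt_def by blast+
    show "pairwise disjnt (components U - {D})"
      using disj unfolding pairwise_def disjnt_def by blast
  qed
  have "\<Union> (components U - {D}) = U - D"
    using in_components_unions_complement[OF assms(2)] by simp
  then show "\<Union> (insert D1 (insert D2 (components U - {D}))) = U - P"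
    using assms(3,4) in_components_subset[OF assms(2)] by auto
  show "open X \<and> connected X \<and> X \<noteq> {}" if X: "X \<in> insert D1 (insert D2 (components U - {D}))" for X
  proof (cases "X \<in> components U")
    case True
    then show ?thesis
      using open_components[OF assms(1)] in_components_connected[of X] in_components_nonempty[of X] by blast
  next
    case False
    then show ?thesis using X assms(5-10) by auto
  qed
qed

subsection \<open>Vertex lists as paths and cycles\<close>

text \<open>
  A set of edges is represented by the symmetric set of its darts (ordered pairs), so cardinalities
  of such sets are twice the number of edges.
\<close>

fun darts :: "'a list \<Rightarrow> ('a \<times> 'a) set" where
  "darts (x # y # p) = insert (x, y) (insert (y, x) (darts (y # p)))"
| "darts _ = {}"

abbreviation closed_darts :: "'a list \<Rightarrow> ('a \<times> 'a) set" where
  "closed_darts p \<equiv> darts (p @ [hd p])"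

lemma finite_darts [simp]: "finite (darts p)"
  by (induction p rule: darts.induct) auto

lemma darts_subset: "darts p \<subseteq> set p \<times> set p"
  by (induction p rule: darts.induct) auto

lemma sym_darts: "sym (darts p)"
  by (induction p rule: darts.induct) (auto simp: sym_def)

lemma fst_darts: "2 \<le> length p \<Longrightarrow> fst ` darts p = set p"
proof (induction p rule: darts.induct)
  case (1 x y p)
  then show ?case by (cases p) (auto simp: insert_commute)
qed auto

lemma darts_join: "darts (p @ a # q) = darts (p @ [a]) \<union> darts (a # q)"
  by (induction p rule: darts.induct; cases q) auto

lemma darts_rev: "darts (rev p) = darts p"
proof (induction p rule: darts.induct)
  case (1 x y p)
  have "darts (rev (x # y # p)) = darts (rev p @ [y]) \<union> darts [y, x]"
    using darts_join[of "rev p" y "[x]"] by simp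
  with 1 show ?case by auto
qed auto

lemma card_darts: "distinct p \<Longrightarrow> card (darts p) = 2 * (length p - 1)"
proof (induction p rule: darts.induct)
  case (1 x y p)
  then have "(x, y) \<notin> darts (y # p)" "(y, x) \<notin> darts (y # p)" "x \<noteq> y"
    using darts_subset[of "y # p"] by auto
  with 1 show ?case by simp
qed auto

lemma disjoint_darts:
  assumes "distinct (p @ a # q)"
  shows "darts (p @ [a]) \<inter> darts (a # q) = {}"
proof (cases p)
  case (Cons x p')
  have "(u, v) \<notin> darts (a # q)" if uv: "(u, v) \<in> darts (p @ [a])" for u v
  proof
    assume "(u, v) \<in> darts (a # q)"
    then have "u = a" "v = a"
      using uv darts_subset[of "p @ [a]"] darts_subset[of "a # q"] assms by auto
    moreover have "(w, w) \<notin> darts r" if "distinct r" for w and r :: "'a list"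
      using that by (induction r rule: darts.induct) auto
    ultimately show False using uv assms by auto
  qed
  then show ?thesis by auto
qed simp

text \<open>The two paths share only the vertices a and b, so a common dart would be an edge between
  these. Then both paths would consist of that edge alone, which the second hypothesis
  excludes.\<close>

lemma closed_darts_split:
  assumes "distinct (a # ys @ b # zs)" "ys \<noteq> [] \<or> zs \<noteq> []"
  shows "closed_darts (a # ys @ b # zs) = darts (a # ys @ [b]) \<union> darts (b # zs @ [a])"
    "darts (a # ys @ [b]) \<inter> darts (b # zs @ [a]) = {}"
proof -
  show "closed_darts (a # ys @ b # zs) = darts (a # ys @ [b]) \<union> darts (b # zs @ [a])"
    using darts_join[of "a # ys" b "zs @ [a]"] by simp
  show "darts (a # ys @ [b]) \<inter> darts (b # zs @ [a]) = {}"
  proof (rule ccontr)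
    assume "darts (a # ys @ [b]) \<inter> darts (b # zs @ [a]) \<noteq> {}"
    then obtain u v where uv: "(u, v) \<in> darts (a # ys @ [b])" "(u, v) \<in> darts (b # zs @ [a])"
      by auto
    have irrefl: "(w, w) \<notin> darts r" if "distinct r" for w and r :: "'a list"
      using that by (induction r rule: darts.induct) auto
    have "u \<in> {a, b}" "v \<in> {a, b}"
      using uv darts_subset[of "a # ys @ [b]"] darts_subset[of "b # zs @ [a]"] assms(1) by auto
    moreover have "u \<noteq> v" using uv irrefl[of "a # ys @ [b]"] assms(1) by auto
    ultimately have "(a, b) \<in> darts (a # ys @ [b])" "(a, b) \<in> darts (b # zs @ [a])"
      using uv sym_darts[of "a # ys @ [b]"] sym_darts[of "b # zs @ [a]"] by (auto dest: symD)
    moreover have "(a, b) \<notin> darts (a # xs @ [b])" if "xs \<noteq> []" "distinct (a # xs @ [b])" for xs and a b :: 'a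
      using that darts_subset[of "xs @ [b]"] by (cases xs) auto
    moreover have "(b, a) \<in> darts (b # zs @ [a])"
      using \<open>(a, b) \<in> darts (b # zs @ [a])\<close> sym_darts by (metis symD)
    ultimately show False using assms by auto
  qed
qed

lemma closed_darts_rotate:
  "closed_darts (p @ a # q) = closed_darts (a # q @ p)"
proof (cases p)
  case (Cons h p')
  then show ?thesis
    using darts_join[of p a "q @ [h]"] darts_join[of "a # q" h "p' @ [a]"] by auto
qed simp

text \<open>This allows a face cycle to be cut at the two ends of an ear, wherever they stand in the
  list.\<close>

lemma cycle_rotate_split:
  assumes "distinct vs" "a \<in> set vs" "b \<in> set vs" "a \<noteq> b"
  obtains ys zs where "distinct (a # ys @ b # zs)" "set (a # ys @ b # zs) = set vs"
    "length (a # ys @ b # zs) = length vs" "closed_darts (a # ys @ b # zs) = closed_darts vs"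
proof -
  obtain p q where vs: "vs = p @ a # q" using assms(2) split_list by metis
  then have "b \<in> set (q @ p)" using assms by auto
  then obtain ys zs where qp: "q @ p = ys @ b # zs" using split_list by metis
  have eq: "a # ys @ b # zs = a # q @ p" using qp by simp
  show ?thesis
    by (rule that[of ys zs]) (use assms(1) vs closed_darts_rotate[of p a q] in \<open>auto simp: eq\<close>)
qed

lemma card_closed_darts:
  assumes "distinct vs" "3 \<le> length vs"
  shows "card (closed_darts vs) = 2 * length vs"
proof -
  obtain a x ys where vs: "vs = a # x # ys" "ys \<noteq> []"
    using assms(2) by (cases vs; cases "tl vs"; cases "tl (tl vs)") auto
  have eq: "closed_darts vs = darts [a, x] \<union> darts (x # ys @ [a])"
    and disj: "darts [a, x] \<inter> darts (x # ys @ [a]) = {}"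
    using closed_darts_split[of a "[]" x ys] assms vs by auto
  have "card (darts (x # ys @ [a])) = 2 * (length ys + 1)"
    using assms vs by (subst card_darts) auto
  moreover have "card (darts [a, x]) = 2"
    using assms vs by (subst card_darts) auto
  ultimately show ?thesis
    unfolding eq using disj vs by (subst card_Un_disjoint) auto
qed

lemma fst_closed_darts: "vs \<noteq> [] \<Longrightarrow> fst ` closed_darts vs = set vs"
  by (subst fst_darts) (auto simp: Suc_le_eq)

subsection \<open>Edge bound for plane graphs\<close>

text \<open>For an ear whose inner part lies in a face, this puts its ends into the closure of that
  face.\<close>

lemma arc_image_subset_closure_interior:
  fixes c :: "real \<Rightarrow> 'a::real_normed_vector"
  assumes "arc c"
  shows "path_image c \<subseteq> closure (path_image c - {pathstart c, pathfinish c})"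
proof -
  let ?I = "path_image c - {pathstart c, pathfinish c}"
  have eq: "?I = c ` {0<..<1}"
    using simple_path_endless[OF arc_imp_simple_path[OF assms]] .
  have "c ` closure {0<..<1} \<subseteq> closure ?I"
    by (rule image_closure_subset)
      (use assms closure_subset[of ?I] eq in \<open>auto simp: arc_def path_def\<close>)
  then show ?thesis by (simp add: path_image_def)
qed

text \<open>Vertices are only the ends of darts, so that every symmetric subset of E carries its own
  vertex set.\<close>

locale plane_graph =
  fixes E :: "('a \<times> 'a) set" and pos :: "'a \<Rightarrow> complex" and \<gamma> :: "'a set \<Rightarrow> real \<Rightarrow> complex"
  assumes finite_E: "finite E" and sym_E: "sym E" and irrefl_E: "irrefl E"
    and inj_pos: "inj_on pos (fst ` E)"
    and arc_edge: "(u, v) \<in> E \<Longrightarrow> arc (\<gamma> {u, v})"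
    and edge_ends: "(u, v) \<in> E \<Longrightarrow> {pathstart (\<gamma> {u, v}), pathfinish (\<gamma> {u, v})} = {pos u, pos v}"
    and edge_vertex: "(u, v) \<in> E \<Longrightarrow> (path_image (\<gamma> {u, v}) - {pos u, pos v}) \<inter> pos ` fst ` E = {}"
    and edge_edge: "(u, v) \<in> E \<Longrightarrow> (x, y) \<in> E \<Longrightarrow> {x, y} \<noteq> {u, v} \<Longrightarrow>
      (path_image (\<gamma> {u, v}) - {pos u, pos v}) \<inter> path_image (\<gamma> {x, y}) = {}"
begin

definition drawn :: "('a \<times> 'a) set \<Rightarrow> complex set" where
  "drawn F = (\<Union>(u, v)\<in>F. path_image (\<gamma> {u, v}))"

lemma drawn_Un: "drawn (F \<union> F') = drawn F \<union> drawn F'"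
  by (simp add: drawn_def)

lemma drawn_mono: "F \<subseteq> F' \<Longrightarrow> drawn F \<subseteq> drawn F'"
  unfolding drawn_def by blast

lemma E_verts: "(u, v) \<in> E \<Longrightarrow> u \<in> fst ` E" "(u, v) \<in> E \<Longrightarrow> v \<in> fst ` E"
  using sym_E by (force dest: symD)+

lemma pos_ends_in_edge: "(u, v) \<in> E \<Longrightarrow> pos u \<in> path_image (\<gamma> {u, v}) \<and> pos v \<in> path_image (\<gamma> {u, v})"
  using edge_ends[of u v] pathstart_in_path_image[of "\<gamma> {u, v}"]
    pathfinish_in_path_image[of "\<gamma> {u, v}"] by (metis doubleton_eq_iff)

lemma closed_drawn: "F \<subseteq> E \<Longrightarrow> closed (drawn F)"
  unfolding drawn_def
  by (intro closed_UN) (auto intro: finite_subset[OF _ finite_E] closed_arc_image arc_edge)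

lemma pos_in_drawn_iff:
  assumes "F \<subseteq> E" "sym F" "w \<in> fst ` E"
  shows "pos w \<in> drawn F \<longleftrightarrow> w \<in> fst ` F"
proof
  assume "pos w \<in> drawn F"
  then obtain u v where uv: "(u, v) \<in> F" "pos w \<in> path_image (\<gamma> {u, v})"
    by (auto simp: drawn_def)
  then have "pos w \<in> {pos u, pos v}" using edge_vertex[of u v] assms by blast
  then have "w = u \<or> w = v"
    using inj_onD[OF inj_pos] assms uv E_verts[of u v] by blast
  then show "w \<in> fst ` F" using uv assms(2) by (force dest: symD)
next
  assume "w \<in> fst ` F"
  then show "pos w \<in> drawn F" using pos_ends_in_edge assms by (fastforce simp: drawn_def)
qed

text \<open>By symmetry, disjoint dart sets share no undirected edge. A common point therefore lies
  on two different edges, hence is an end of one of them, and a vertex on a drawing belongs to the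
  drawn set.\<close>

lemma drawn_Int:
  assumes "F \<subseteq> E" "sym F" "F' \<subseteq> E" "sym F'" "F \<inter> F' = {}"
  shows "drawn F \<inter> drawn F' = pos ` (fst ` F \<inter> fst ` F')"
proof (intro equalityI subsetI)
  fix z assume "z \<in> drawn F \<inter> drawn F'"
  then obtain u v x y where uv: "(u, v) \<in> F" "z \<in> path_image (\<gamma> {u, v})"
    and xy: "(x, y) \<in> F'" "z \<in> path_image (\<gamma> {x, y})"
    by (auto simp: drawn_def)
  have "{x, y} \<noteq> {u, v}"
    using uv xy assms(4,5) by (auto simp: doubleton_eq_iff dest: symD)
  then have "z \<in> {pos u, pos v}"
    using edge_edge[of u v x y] uv xy assms by blast
  then obtain w where w: "z = pos w" "w \<in> fst ` E"
    using uv assms(1) E_verts[of u v] by blast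
  then have "w \<in> fst ` F \<inter> fst ` F'"
    using pos_in_drawn_iff \<open>z \<in> drawn F \<inter> drawn F'\<close> assms by blast
  with w show "z \<in> pos ` (fst ` F \<inter> fst ` F')" by blast
next
  fix z assume "z \<in> pos ` (fst ` F \<inter> fst ` F')"
  then show "z \<in> drawn F \<inter> drawn F'"
    using pos_in_drawn_iff assms by blast
qed

lemma path_arc:
  assumes "distinct p" "2 \<le> length p" "darts p \<subseteq> E"
  obtains c where "arc c" "path_image c = drawn (darts p)" "pathstart c = pos (hd p)"
    "pathfinish c = pos (last p)"
proof -
  have edge: "\<exists>c. arc c \<and> path_image c = path_image (\<gamma> {u, v}) \<and> pathstart c = pos u \<and> pathfinish c = pos v"
    if uv: "(u, v) \<in> E" for u v
  proof -
    consider "pathstart (\<gamma> {u, v}) = pos u" "pathfinish (\<gamma> {u, v}) = pos v"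
      | "pathstart (\<gamma> {u, v}) = pos v" "pathfinish (\<gamma> {u, v}) = pos u"
      using edge_ends[OF uv] by (auto simp: doubleton_eq_iff)
    then show ?thesis
    proof cases
      case 1
      then show ?thesis using arc_edge[OF uv] by blast
    next
      case 2
      then show ?thesis using arc_edge[OF uv]
        by (intro exI[of _ "reversepath (\<gamma> {u, v})"]) (auto simp: arc_reversepath)
    qed
  qed
  have "\<exists>c. arc c \<and> path_image c = drawn (darts p) \<and> pathstart c = pos (hd p) \<and> pathfinish c = pos (last p)"
    using assms
  proof (induction p rule: darts.induct)
    case (1 x y p)
    from 1(4) have xy: "(x, y) \<in> E" by simp
    obtain c where c: "arc c" "path_image c = path_image (\<gamma> {x, y})" "pathstart c = pos x" "pathfinish c = pos y"
      using edge[OF xy] by blast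
    have eq: "drawn (darts [x, y]) = path_image c"
      by (auto simp: drawn_def c(2) insert_commute)
    show ?case
    proof (cases p)
      case Nil
      with c eq show ?thesis by (intro exI[of _ c]) simp
    next
      case (Cons z q)
      then obtain d where d: "arc d" "path_image d = drawn (darts (y # p))" "pathstart d = pos y"
          "pathfinish d = pos (last p)"
        using 1 by force
      have "drawn (darts [x, y]) \<inter> drawn (darts (y # p)) = pos ` (fst ` darts [x, y] \<inter> fst ` darts (y # p))"
        using 1(4) disjoint_darts[of "[x]" y p] 1(2) sym_darts[of "[x, y]"] sym_darts by (intro drawn_Int) auto
      also have "fst ` darts [x, y] \<inter> fst ` darts (y # p) = {y}"
        using 1(2) Cons by (subst (1 2) fst_darts) auto
      finally have "path_image c \<inter> path_image d \<subseteq> {pathstart d}"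
        using d eq by simp
      then have "arc (c +++ d)" using c d by (intro arc_join) auto
      moreover have "path_image (c +++ d) = drawn (darts (x # y # p))"
        using c(4) d eq darts_join[of "[x]" y p] by (simp add: path_image_join drawn_Un del: darts.simps)
      ultimately show ?thesis
        using c d Cons by (intro exI[of _ "c +++ d"]) auto
    qed
  qed auto
  then show ?thesis using that by blast
qed

lemma cycle_arcs:
  assumes "distinct (a # ys @ b # zs)" "ys \<noteq> [] \<or> zs \<noteq> []" "closed_darts (a # ys @ b # zs) \<subseteq> E"
  obtains c1 c2 where "arc c1" "arc c2" "pathstart c1 = pos a" "pathfinish c1 = pos b"
    "pathstart c2 = pos a" "pathfinish c2 = pos b"
    "path_image c1 = drawn (darts (a # ys @ [b]))" "path_image c2 = drawn (darts (b # zs @ [a]))"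
    "path_image c1 \<inter> path_image c2 = {pos a, pos b}"
proof -
  note split = closed_darts_split[OF assms(1,2)]
  obtain c1 where c1: "arc c1" "path_image c1 = drawn (darts (a # ys @ [b]))"
      "pathstart c1 = pos a" "pathfinish c1 = pos b"
    using path_arc[of "a # ys @ [b]"] assms split by auto
  \<comment> \<open>The second path is traversed backwards so that both arcs run from a to b, as the
    theta lemmas require.\<close>
  obtain c2 where c2: "arc c2" "path_image c2 = drawn (darts (b # zs @ [a]))"
      "pathstart c2 = pos a" "pathfinish c2 = pos b"
    using path_arc[of "rev (b # zs @ [a])"] assms split by (auto simp: darts_rev simp del: rev.simps) auto
  have "drawn (darts (a # ys @ [b])) \<inter> drawn (darts (b # zs @ [a])) =
      pos ` (fst ` darts (a # ys @ [b]) \<inter> fst ` darts (b # zs @ [a]))"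
    using assms split by (intro drawn_Int) (auto simp: sym_darts)
  also have "fst ` darts (a # ys @ [b]) \<inter> fst ` darts (b # zs @ [a]) = {a, b}"
    using assms(1) by (subst (1 2) fst_darts) auto
  finally show ?thesis using c1 c2 by (intro that[of c1 c2]) auto
qed

text \<open>
  The last two conditions are Euler's formula and the count of edge-face incidences, both doubled.
  The cycle assigned to a face is its boundary, although only the weaker condition that the face is
  a complementary component of that cycle has to be maintained.
\<close>

definition has_face_cycles :: "('a \<times> 'a) set \<Rightarrow> bool" where
  "has_face_cycles F \<longleftrightarrow> (\<exists>cyc. finite (components (- drawn F)) \<and>
     (\<forall>D\<in>components (- drawn F). distinct (cyc D) \<and> 3 \<le> length (cyc D) \<and>
        closed_darts (cyc D) \<subseteq> F \<and> D \<in> components (- drawn (closed_darts (cyc D)))) \<and>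
     2 * card (components (- drawn F)) + 2 * card (fst ` F) = card F + 4 \<and>
     (\<Sum>D\<in>components (- drawn F). length (cyc D)) = card F)"

text \<open>Both Jordan components receive the cycle itself; its length counted twice is the number
  of darts.\<close>

lemma has_face_cycles_cycle:
  assumes "distinct vs" "3 \<le> length vs" "closed_darts vs \<subseteq> E"
  shows "has_face_cycles (closed_darts vs)"
proof -
  obtain a b zs where vs: "vs = a # [] @ b # zs" "zs \<noteq> []"
    using assms(2) by (cases vs; cases "tl vs"; cases "tl (tl vs)") auto
  obtain c1 c2 where c: "arc c1" "arc c2" "pathstart c1 = pos a" "pathfinish c1 = pos b"
    "pathstart c2 = pos a" "pathfinish c2 = pos b"
    "path_image c1 = drawn (darts (a # [] @ [b]))" "path_image c2 = drawn (darts (b # zs @ [a]))"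
    "path_image c1 \<inter> path_image c2 = {pos a, pos b}"
    by (rule cycle_arcs[of a "[]" b zs]) (use assms vs in auto)
  have img: "path_image c1 \<union> path_image c2 = drawn (closed_darts vs)"
    using closed_darts_split(1)[of a "[]" b zs] assms vs c(7,8) by (simp add: drawn_Un del: darts.simps)
  obtain I U where IU: "components (- (path_image c1 \<union> path_image c2)) = {I, U}" "I \<noteq> U"
    by (rule Jordan_components[OF c(1-6,9)])
  have "card (components (- drawn (closed_darts vs))) = 2"
    using IU img by simp
  moreover have "fst ` closed_darts vs = set vs"
    using assms(2) by (intro fst_closed_darts) auto
  ultimately show ?thesis
    unfolding has_face_cycles_def
    using IU img assms card_closed_darts[OF assms(1,2)]
    by (intro exI[of _ "\<lambda>_. vs"]) (auto simp: distinct_card)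
qed

text \<open>The inside of the ear is connected and avoids the drawing, so it lies in one face D. The
  cycle of D and the ear form a theta curve: D is replaced by two faces and all others
  remain.\<close>

lemma has_face_cycles_ear:
  assumes F: "has_face_cycles F" "F \<subseteq> E" "sym F"
    and ear: "distinct (a # ks @ [b])" "darts (a # ks @ [b]) \<subseteq> E" "darts (a # ks @ [b]) \<inter> F = {}"
      "a \<in> fst ` F" "b \<in> fst ` F" "set ks \<inter> fst ` F = {}"
  shows "has_face_cycles (F \<union> darts (a # ks @ [b]))"
proof -
  let ?P = "darts (a # ks @ [b])"
  define \<F> where "\<F> = components (- drawn F)"
  obtain cyc where fin: "finite \<F>"
    and cyc: "\<And>D. D \<in> \<F> \<Longrightarrow> distinct (cyc D) \<and> 3 \<le> length (cyc D) \<and>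
        closed_darts (cyc D) \<subseteq> F \<and> D \<in> components (- drawn (closed_darts (cyc D)))"
    and euler: "2 * card \<F> + 2 * card (fst ` F) = card F + 4"
    and total: "(\<Sum>D\<in>\<F>. length (cyc D)) = card F"
    using F(1) unfolding has_face_cycles_def \<F>_def by blast
  obtain c3 where c3: "arc c3" "path_image c3 = drawn ?P" "pathstart c3 = pos a" "pathfinish c3 = pos b"
    using path_arc[of "a # ks @ [b]"] ear by auto
  have fstP: "fst ` ?P = insert a (insert b (set ks))"
    by (subst fst_darts) auto
  have "drawn ?P \<inter> drawn F = pos ` (fst ` ?P \<inter> fst ` F)"
    using ear F sym_darts by (intro drawn_Int) auto
  also have "fst ` ?P \<inter> fst ` F = {a, b}"
    unfolding fstP using ear by auto
  finally have PF: "path_image c3 \<inter> drawn F = {pos a, pos b}"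
    using c3 by simp
  define Q where "Q = path_image c3 - {pos a, pos b}"
  have Q: "connected Q" "Q \<noteq> {}" "Q \<subseteq> - drawn F"
    using connected_simple_path_endless[of c3] nonempty_simple_path_endless[of c3]
      arc_imp_simple_path[OF c3(1)] PF c3(3,4) unfolding Q_def by auto
  then obtain D where D: "D \<in> \<F>" "Q \<subseteq> D"
    using exists_component_superset[of Q "- drawn F"] unfolding \<F>_def by blast
  have D': "distinct (cyc D)" "3 \<le> length (cyc D)" "closed_darts (cyc D) \<subseteq> F"
      "D \<in> components (- drawn (closed_darts (cyc D)))"
    using cyc[OF D(1)] by auto
  have DF: "D \<inter> drawn F = {}"
    using D(1) in_components_subset unfolding \<F>_def by blast
  \<comment> \<open>An end of the ear is a limit of points of D but lies on the drawing, hence on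
    the frontier of D, which is contained in the drawn cycle.\<close>
  have on_cycle: "w \<in> set (cyc D)" if w: "w \<in> {a, b}" for w
  proof -
    have wF: "w \<in> fst ` F" "w \<in> fst ` E" using w ear F by auto
    have "pos w \<in> path_image c3" using PF w by blast
    then have "pos w \<in> closure D"
      using arc_image_subset_closure_interior[OF c3(1)] closure_mono[OF D(2)] c3(3,4)
      unfolding Q_def by auto
    moreover have "pos w \<notin> D"
      using DF pos_in_drawn_iff[OF F(2,3)] wF by blast
    ultimately have "pos w \<in> frontier D"
      using interior_subset[of D] unfolding frontier_def by blast
    also have "frontier D \<subseteq> drawn (closed_darts (cyc D))"
      by (intro frontier_of_components_closed_complement closed_drawn D') (use D' F in auto)
    finally have "w \<in> fst ` closed_darts (cyc D)"
      using pos_in_drawn_iff[OF _ sym_darts] D' F wF by blast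
    then show ?thesis using D'(2) by (subst (asm) fst_closed_darts) auto
  qed
  have ab: "a \<noteq> b" using ear by auto
  obtain ys zs where rot: "distinct (a # ys @ b # zs)" "set (a # ys @ b # zs) = set (cyc D)"
    "length (a # ys @ b # zs) = length (cyc D)" "closed_darts (a # ys @ b # zs) = closed_darts (cyc D)"
    by (rule cycle_rotate_split[OF D'(1) on_cycle on_cycle ab]) auto
  have yz: "ys \<noteq> [] \<or> zs \<noteq> []" using rot(3) D'(2) by auto
  have split: "closed_darts (cyc D) = darts (a # ys @ [b]) \<union> darts (b # zs @ [a])"
    using closed_darts_split[OF rot(1) yz] rot(4) by simp
  have subF: "darts (a # ys @ [b]) \<subseteq> F" "darts (b # zs @ [a]) \<subseteq> F"
    using split D'(3) by auto
  obtain c1 c2 where c: "arc c1" "arc c2" "pathstart c1 = pos a" "pathfinish c1 = pos b"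
    "pathstart c2 = pos a" "pathfinish c2 = pos b"
    "path_image c1 = drawn (darts (a # ys @ [b]))" "path_image c2 = drawn (darts (b # zs @ [a]))"
    "path_image c1 \<inter> path_image c2 = {pos a, pos b}"
    by (rule cycle_arcs[OF rot(1) yz]) (use rot(4) D'(3) F(2) in auto)
  have sub: "path_image c1 \<subseteq> drawn F" "path_image c2 \<subseteq> drawn F"
    using drawn_mono[OF subF(1)] drawn_mono[OF subF(2)] c(7,8) by simp_all
  have "pos a \<in> path_image c1" "pos b \<in> path_image c1" "pos a \<in> path_image c2" "pos b \<in> path_image c2"
    using c(9) by auto
  then have int: "path_image c1 \<inter> path_image c3 = {pos a, pos b}" "path_image c2 \<inter> path_image c3 = {pos a, pos b}"
    using sub PF by blast+
  have "D \<in> components (- (path_image c1 \<union> path_image c2))"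
    using D'(4) split c by (simp add: drawn_Un)
  then obtain D1 D2 where Ds: "D1 \<in> components (- (path_image c1 \<union> path_image c3))"
    "D2 \<in> components (- (path_image c2 \<union> path_image c3))"
    "D1 \<inter> D2 = {}" "D - path_image c3 = D1 \<union> D2"
    by (rule theta_split[OF c(1,2) c3(1) c(3-6) c3(3,4) c(9) int]) (use D(2) Q_def in auto)
  \<comment> \<open>Each new cycle consists of one half of the old cycle and the ear, which is run
    backwards in the first and forwards in the second.\<close>
  let ?vs1 = "a # ys @ b # rev ks" and ?vs2 = "b # zs @ a # ks"
  have "fst ` darts (a # ys @ [b]) = set (a # ys @ [b])" "fst ` darts (b # zs @ [a]) = set (b # zs @ [a])"
    by (simp_all add: fst_darts)
  then have "set ys \<subseteq> fst ` F" "set zs \<subseteq> fst ` F"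
    using image_mono[OF subF(1), of fst] image_mono[OF subF(2), of fst] by simp_all
  then have "set ys \<inter> set ks = {}" "set zs \<inter> set ks = {}"
    using ear(6) by blast+
  then have dist: "distinct ?vs1" "distinct ?vs2"
    using rot(1) ear(1) by (simp_all add: Int_commute eq_commute)
  \<comment> \<open>If a half of the cycle and the ear both were single edges, the ear would already
    belong to F. This keeps the new cycles at length 3 or more.\<close>
  have no_short: "xs \<noteq> [] \<or> ks \<noteq> []" if "darts (u # xs @ [v]) \<subseteq> F" "{u, v} = {a, b}" for u v xs
    using that ear(3) by (auto simp: doubleton_eq_iff)
  have ne: "ys \<noteq> [] \<or> rev ks \<noteq> []" "zs \<noteq> [] \<or> ks \<noteq> []"
    using no_short[OF subF(1)] no_short[OF subF(2)] by auto
  have revP: "darts (b # rev ks @ [a]) = ?P"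
    using darts_rev[of "a # ks @ [b]"] by simp
  have closed1: "closed_darts ?vs1 = darts (a # ys @ [b]) \<union> ?P"
    using closed_darts_split(1)[OF dist(1) ne(1)] revP by simp
  have closed2: "closed_darts ?vs2 = darts (b # zs @ [a]) \<union> ?P"
    using closed_darts_split(1)[OF dist(2) ne(2)] by simp
  have clos: "closed (path_image c1 \<union> path_image c3)" "closed (path_image c2 \<union> path_image c3)"
    by (intro closed_Un closed_arc_image c c3)+
  have open_Ds: "open D1" "open D2"
    using open_components[OF open_Compl[OF clos(1)] Ds(1)] open_components[OF open_Compl[OF clos(2)] Ds(2)]
    by auto
  have Dsprop: "connected D1" "D1 \<noteq> {}" "connected D2" "D2 \<noteq> {}"
    using Ds(1,2) in_components_connected in_components_nonempty by blast+
  have "components (- drawn F - path_image c3) = insert D1 (insert D2 (components (- drawn F) - {D}))"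
  proof (rule components_split_component[OF _ _ Ds(4) _ open_Ds(1) Dsprop(1,2) open_Ds(2) Dsprop(3,4) Ds(3)])
    show "open (- drawn F)" using closed_drawn[OF F(2)] by (rule open_Compl)
    show "D \<in> components (- drawn F)" using D(1) unfolding \<F>_def .
    show "path_image c3 \<inter> - drawn F \<subseteq> D" using D(2) PF unfolding Q_def by blast
  qed
  then have comps: "components (- drawn (F \<union> ?P)) = insert D1 (insert D2 (\<F> - {D}))"
    using c3(2) by (simp add: \<F>_def drawn_Un Compl_Un Diff_eq)
  have "D1 \<subseteq> D" "D2 \<subseteq> D" using Ds(4) by auto
  moreover have "X \<notin> \<F> - {D}" if "X \<subseteq> D" "X \<noteq> {}" for X
    using components_nonoverlap[of D "- drawn F" X] D(1) that unfolding \<F>_def by auto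
  ultimately have new: "D1 \<notin> \<F> - {D}" "D2 \<notin> \<F> - {D}" "D1 \<noteq> D2"
    using Dsprop Ds(3) by auto
  define cyc' where "cyc' = cyc(D1 := ?vs1, D2 := ?vs2)"
  have cyc'_old: "cyc' X = cyc X" if "X \<in> \<F> - {D}" for X
    using that new by (auto simp: cyc'_def)
  have cyc'_new: "cyc' D1 = ?vs1" "cyc' D2 = ?vs2"
    using new by (auto simp: cyc'_def)
  have card\<F>: "card \<F> = Suc (card (\<F> - {D}))"
    using D(1) fin by (metis card_Suc_Diff1)
  have cardF: "card (F \<union> ?P) = card F + 2 * (length ks + 1)"
    using ear(3) finite_subset[OF F(2) finite_E] card_darts[OF ear(1)]
    by (subst card_Un_disjoint) auto
  have "fst ` (F \<union> ?P) = fst ` F \<union> set ks"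
    unfolding image_Un fstP using ear by auto
  then have cardV: "card (fst ` (F \<union> ?P)) = card (fst ` F) + length ks"
    using ear(1,6) finite_subset[OF F(2) finite_E]
    by (simp add: card_Un_disjoint Int_commute distinct_card)
  have totalD: "card F = length (cyc D) + (\<Sum>X\<in>\<F> - {D}. length (cyc X))"
    unfolding total[symmetric] by (rule sum.remove[OF fin D(1)])
  have cond: "distinct (cyc' X) \<and> 3 \<le> length (cyc' X) \<and> closed_darts (cyc' X) \<subseteq> F \<union> ?P \<and>
      X \<in> components (- drawn (closed_darts (cyc' X)))"
    if X: "X \<in> insert D1 (insert D2 (\<F> - {D}))" for X
  proof -
    consider "X = D1" | "X = D2" | "X \<in> \<F> - {D}" using X by blast
    then show ?thesis
    proof cases
      case 1
      have "2 + (length ys + length ks) = length ?vs1" "length ys + length ks \<ge> 1"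
        using ne(1) by (cases ys; cases ks; simp)+
      then have "3 \<le> length ?vs1" by linarith
      moreover have "D1 \<in> components (- drawn (closed_darts ?vs1))"
        using Ds(1) unfolding closed1 drawn_Un c(7) c3(2) .
      moreover have "closed_darts ?vs1 \<subseteq> F \<union> ?P" unfolding closed1 using subF(1) by (rule Un_mono[OF _ order_refl])
      ultimately show ?thesis unfolding 1 cyc'_new using dist(1) by (intro conjI)
    next
      case 2
      have "2 + (length zs + length ks) = length ?vs2" "length zs + length ks \<ge> 1"
        using ne(2) by (cases zs; cases ks; simp)+
      then have "3 \<le> length ?vs2" by linarith
      moreover have "D2 \<in> components (- drawn (closed_darts ?vs2))"
        using Ds(2) unfolding closed2 drawn_Un c(8) c3(2) .
      moreover have "closed_darts ?vs2 \<subseteq> F \<union> ?P" unfolding closed2 using subF(2) by (rule Un_mono[OF _ order_refl])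
      ultimately show ?thesis unfolding 2 cyc'_new using dist(2) by (intro conjI)
    next
      case 3
      then show ?thesis using cyc[of X] cyc'_old[OF 3] by auto
    qed
  qed
  \<comment> \<open>One face, \<open>length ks\<close> vertices and 2 (\<open>length ks\<close> + 1)
    darts are added, which preserves Euler's formula. The two new cycles together are longer than
    the old one by as much as there are new darts, since each contains a, b and
    \<open>ks\<close>.\<close>
  have card_new: "card (insert D1 (insert D2 (\<F> - {D}))) = card \<F> + 1"
    using card_insert_disjoint[OF finite_Diff[OF fin] new(2)] new(1,3) fin card\<F>
      card_insert_disjoint[of "insert D2 (\<F> - {D})" D1]
    by (simp only: finite_insert finite_Diff insert_iff simp_thms)
  have "2 * card (insert D1 (insert D2 (\<F> - {D}))) + 2 * card (fst ` (F \<union> ?P)) = card (F \<union> ?P) + 4"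
    unfolding card_new cardV cardF using euler by simp
  moreover have "(\<Sum>X\<in>insert D1 (insert D2 (\<F> - {D})). length (cyc' X)) = card (F \<union> ?P)"
  proof -
    have "(\<Sum>X\<in>insert D1 (insert D2 (\<F> - {D})). length (cyc' X)) =
        length ?vs1 + (length ?vs2 + (\<Sum>X\<in>\<F> - {D}. length (cyc' X)))"
      using new(3) sum.insert[OF finite_Diff[OF fin] new(2), of "\<lambda>X. length (cyc' X)"]
        sum.insert[of "insert D2 (\<F> - {D})" D1 "\<lambda>X. length (cyc' X)"] new(1) fin
      unfolding cyc'_new by (simp only: finite_insert finite_Diff insert_iff simp_thms)
    also have "(\<Sum>X\<in>\<F> - {D}. length (cyc' X)) = (\<Sum>X\<in>\<F> - {D}. length (cyc X))"
      using cyc'_old by (intro sum.cong) auto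
    finally show ?thesis using cardF totalD rot(3) by simp
  qed
  ultimately show ?thesis
    unfolding has_face_cycles_def comps using fin cond by (intro exI[of _ cyc']) auto
qed

end

section \<open>Gluing ear-built pieces at cut vertices\<close>

lemma rtrancl_darts_path:
  assumes "(d, e) \<in> R\<^sup>*" "sym R"
  obtains p where "distinct p" "p \<noteq> []" "hd p = d" "last p = e" "darts p \<subseteq> R"
proof -
  from assms(1) have "\<exists>p. distinct p \<and> p \<noteq> [] \<and> hd p = d \<and> last p = e \<and> darts p \<subseteq> R"
  proof (induction rule: rtrancl_induct)
    case base
    show ?case by (intro exI[of _ "[d]"]) auto
  next
    case (step e f)
    then obtain p where p: "distinct p" "p \<noteq> []" "hd p = d" "last p = e" "darts p \<subseteq> R" by blast
    show ?case
    proof (cases "f \<in> set p")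
      case True
      then obtain p1 p2 where "p = p1 @ f # p2" by (meson split_list)
      with p darts_join[of p1 f p2] show ?thesis
        by (intro exI[of _ "p1 @ [f]"]) (auto simp: hd_append)
    next
      case False
      obtain q where q: "p = q @ [e]" using p by (metis append_butlast_last_id)
      have "darts (p @ [f]) = darts p \<union> darts [e, f]"
        unfolding q using darts_join[of q e "[f]"] by simp
      with p False step(2) assms(2) show ?thesis
        by (intro exI[of _ "p @ [f]"]) (auto dest: symD)
    qed
  qed
  then show ?thesis using that by blast
qed

context plane_graph
begin

text \<open>Only the invariant of the construction is recorded, not the sequence of ears. The single
  edge, which has no face cycle, is the starting piece and also covers bridges.\<close>

definition ear_built :: "('a \<times> 'a) set \<Rightarrow> bool" where
  "ear_built H \<longleftrightarrow> has_face_cycles H \<or> (\<exists>u v. u \<noteq> v \<and> H = darts [u, v])"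

lemma ear_built_ear:
  assumes F: "ear_built F" "F \<subseteq> E" "sym F"
    and ear: "distinct (a # ks @ [b])" "darts (a # ks @ [b]) \<subseteq> E" "darts (a # ks @ [b]) \<inter> F = {}"
      "a \<in> fst ` F" "b \<in> fst ` F" "set ks \<inter> fst ` F = {}"
  shows "ear_built (F \<union> darts (a # ks @ [b]))"
proof (cases "has_face_cycles F")
  case True
  then show ?thesis
    unfolding ear_built_def using has_face_cycles_ear[OF _ assms(2-)] by blast
next
  case False
  then obtain u v where uv: "F = darts [u, v]" using F(1) unfolding ear_built_def by blast
  \<comment> \<open>The first ear joins the two ends of the single edge, so it closes that edge to a
    cycle.\<close>
  have "F = darts [b, a]" using ear(1,4,5) unfolding uv by auto
  then have eq: "F \<union> darts (a # ks @ [b]) = closed_darts (a # ks @ [b])"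
    using darts_join[of "a # ks" b "[a]"] by auto
  have "ks \<noteq> []" using ear(3) \<open>F = darts [b, a]\<close> by auto
  then have "3 \<le> length (a # ks @ [b])" by (cases ks) auto
  moreover have "closed_darts (a # ks @ [b]) \<subseteq> E" unfolding eq[symmetric] using F ear by blast
  ultimately have "has_face_cycles (closed_darts (a # ks @ [b]))"
    using has_face_cycles_cycle ear(1) by blast
  then show ?thesis unfolding ear_built_def eq by blast
qed

text \<open>For f faces, d darts and n vertices, g f \<le> d and 2 f + 2 n = d + 4 even give 4 g in
  place of 2 g. The weaker form also holds for a single edge and is stable under gluing.\<close>

lemma ear_built_edge_bound:
  assumes "ear_built F" "F \<subseteq> E"
    and girth: "\<And>vs. distinct vs \<Longrightarrow> 3 \<le> length vs \<Longrightarrow> closed_darts vs \<subseteq> E \<Longrightarrow> g \<le> length vs"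
  shows "g * card F + 2 * g \<le> 2 * card F + 2 * g * card (fst ` F)"
  using assms(1) unfolding ear_built_def
proof
  assume "has_face_cycles F"
  then obtain cyc where cyc: "\<And>D. D \<in> components (- drawn F) \<Longrightarrow> distinct (cyc D) \<and> 3 \<le> length (cyc D) \<and>
        closed_darts (cyc D) \<subseteq> F"
    and euler: "2 * card (components (- drawn F)) + 2 * card (fst ` F) = card F + 4"
    and total: "(\<Sum>D\<in>components (- drawn F). length (cyc D)) = card F"
    unfolding has_face_cycles_def by blast
  have "g \<le> length (cyc D)" if D: "D \<in> components (- drawn F)" for D
    using girth[of "cyc D"] cyc[OF D] assms(2) by blast
  then have "card (components (- drawn F)) * g \<le> card F"
    unfolding total[symmetric] by (rule sum_bounded_below[where 'a = nat, simplified])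
  moreover have "g * card F + 4 * g = g * (2 * card (components (- drawn F)) + 2 * card (fst ` F))"
    unfolding euler by (simp add: algebra_simps)
  ultimately show ?thesis by (simp add: algebra_simps)
next
  assume "\<exists>u v. u \<noteq> v \<and> F = darts [u, v]"
  then obtain u v where "u \<noteq> v" "F = darts [u, v]" by blast
  then have "card F = 2" "card (fst ` F) = 2" by auto
  then show ?thesis by simp
qed

text \<open>A maximal ear-built H inside F has no ear in F. If it is not all of F, the edges
  touching a component K outside H are split off. Two attachment vertices of K would be joined by an
  ear through K, so both parts share at most one vertex, and induction applies to each.\<close>

lemma edge_bound:
  assumes "F \<subseteq> E" "sym F" "F \<noteq> {}"
    and girth: "\<And>vs. distinct vs \<Longrightarrow> 3 \<le> length vs \<Longrightarrow> closed_darts vs \<subseteq> E \<Longrightarrow> g \<le> length vs"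
  shows "g * card F + 2 * g \<le> 2 * card F + 2 * g * card (fst ` F)"
  using assms(1-3)
proof (induction "card F" arbitrary: F rule: less_induct)
  case less
  have finF: "finite F" using less.prems finite_E finite_subset by blast
  define \<H> where "\<H> = {H. H \<subseteq> F \<and> sym H \<and> ear_built H}"
  have "finite \<H>" using finF unfolding \<H>_def by simp
  moreover have "\<H> \<noteq> {}"
  proof -
    obtain u v where uv: "(u, v) \<in> F" using less.prems by auto
    then have "u \<noteq> v" using irrefl_E less.prems by (auto simp: irrefl_def)
    then have "darts [u, v] \<in> \<H>"
      using uv less.prems(2) sym_darts[of "[u, v]"] unfolding \<H>_def ear_built_def by (auto dest: symD)
    then show ?thesis by blast
  qed
  ultimately obtain H where H: "H \<in> \<H>" and max: "\<And>H'. H' \<in> \<H> \<Longrightarrow> H \<subseteq> H' \<Longrightarrow> H = H'"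
    using finite_has_maximal[of \<H>] by blast
  have H': "H \<subseteq> F" "sym H" "ear_built H" "H \<subseteq> E" using H less.prems unfolding \<H>_def by auto
  show ?case
  proof (cases "H = F")
    case True
    then show ?thesis using ear_built_edge_bound[OF H'(3,4) girth] by simp
  next
    case False
    define V where "V = fst ` H"
    have no_ear: False if ear: "distinct (a # ks @ [b])" "darts (a # ks @ [b]) \<subseteq> F"
        "darts (a # ks @ [b]) \<inter> H = {}" "a \<in> V" "b \<in> V" "set ks \<inter> V = {}" for a ks b
    proof -
      have "ear_built (H \<union> darts (a # ks @ [b]))"
        using ear less.prems(1) unfolding V_def by (intro ear_built_ear H') auto
      moreover have "sym (H \<union> darts (a # ks @ [b]))" using H'(2) sym_darts by (rule sym_Un)
      ultimately have "H \<union> darts (a # ks @ [b]) \<in> \<H>" using ear H' unfolding \<H>_def by auto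
      then have "darts (a # ks @ [b]) \<subseteq> H" using max by blast
      then have "darts (a # ks @ [b]) = {}" using ear(3) by blast
      then show False by (cases ks) auto
    qed
    have H_V: "u \<in> V \<and> v \<in> V" if uv: "(u, v) \<in> H" for u v
      unfolding V_def using uv H'(2) by (force dest: symD)
    \<comment> \<open>An edge of F outside H with both ends on H would itself be an ear.\<close>
    obtain x y where xy: "(x, y) \<in> F" "y \<notin> V"
    proof -
      obtain x y where xy: "(x, y) \<in> F" "(x, y) \<notin> H" using False H' by auto
      then have yx: "(y, x) \<in> F" "(y, x) \<notin> H" using less.prems(2) H'(2) by (auto dest: symD)
      have "x \<noteq> y" using irrefl_E less.prems(1) xy(1) by (auto simp: irrefl_def)
      then have "\<not> (x \<in> V \<and> y \<in> V)" using no_ear[of x "[]" y] xy yx by auto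
      then show ?thesis using that[OF xy(1)] that[OF yx(1)] by blast
    qed
    define R where "R = F \<inter> (- V) \<times> (- V)"
    have symR: "sym R" using less.prems(2) unfolding R_def sym_def by blast
    define K where "K = R\<^sup>* `` {y}"
    have "K \<inter> V = {}"
    proof -
      have "z \<notin> V" if "(y, z) \<in> R\<^sup>*" for z
        using that xy(2) unfolding R_def by (cases rule: rtranclE) auto
      then show ?thesis unfolding K_def by blast
    qed
    have K_step: "w \<in> K" if "z \<in> K" "(z, w) \<in> R" for z w
      using that unfolding K_def by (auto intro: rtrancl_into_rtrancl)
    have yK: "y \<in> K" unfolding K_def by blast
    define F2 where "F2 = F \<inter> {(u, v). u \<in> K \<or> v \<in> K}"
    define F1 where "F1 = F - F2"
    have syms: "sym F1" "sym F2"
      using less.prems(2) unfolding F1_def F2_def sym_def by blast+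
    have HF1: "H \<subseteq> F1" using H'(1) H_V \<open>K \<inter> V = {}\<close> unfolding F1_def F2_def by blast
    have "H \<noteq> {}"
    \<comment> \<open>Euler's formula would give the empty drawing two faces, whose cycles have
      length at least 3 but total length 0.\<close>
    proof
      assume "H = {}"
      then have "has_face_cycles {}" using H'(3) unfolding ear_built_def by auto
      then obtain cyc where "2 * card (components (- drawn {})) = 4"
        "(\<Sum>D\<in>components (- drawn {}). length (cyc D)) = 0"
        "\<And>D. D \<in> components (- drawn {}) \<Longrightarrow> 3 \<le> length (cyc D)"
        "finite (components (- drawn {}))"
        unfolding has_face_cycles_def by auto
      then show False by fastforce
    qed
    then have ne: "F1 \<noteq> {}" "F2 \<noteq> {}" using HF1 xy(1) yK unfolding F2_def by auto
    have F12: "F = F1 \<union> F2" "F1 \<inter> F2 = {}" unfolding F1_def F2_def by auto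
    have cardF: "card F = card F1 + card F2"
      using finF unfolding F12(1) by (intro card_Un_disjoint F12) auto
    have fins: "finite F1" "finite F2" using finF F12(1) by auto
    then have "card F1 > 0" "card F2 > 0" using ne by (auto simp: card_gt_0_iff)
    then have smaller: "card F1 < card F" "card F2 < card F" using cardF by linarith+
    have subs: "F1 \<subseteq> E" "F2 \<subseteq> E" using less.prems(1) F12(1) by auto
    have IH: "g * card F1 + 2 * g \<le> 2 * card F1 + 2 * g * card (fst ` F1)"
        "g * card F2 + 2 * g \<le> 2 * card F2 + 2 * g * card (fst ` F2)"
      using less.hyps[OF smaller(1) subs(1) syms(1) ne(1)] less.hyps[OF smaller(2) subs(2) syms(2) ne(2)] .
    have attach: "a \<in> V \<and> (\<exists>d\<in>K. (a, d) \<in> F)" if a: "a \<in> fst ` F1 \<inter> fst ` F2" for a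
    proof -
      obtain c d where cd: "(a, c) \<in> F1" "(a, d) \<in> F2" using a by auto
      then have "a \<notin> K" unfolding F1_def F2_def by auto
      then have d: "d \<in> K" "(a, d) \<in> F" using cd(2) unfolding F2_def by auto
      then have "d \<notin> V" "(d, a) \<in> F" using \<open>K \<inter> V = {}\<close> less.prems(2) by (auto dest: symD)
      then have "a \<in> V" using K_step[OF d(1), of a] \<open>a \<notin> K\<close> unfolding R_def by auto
      with d show ?thesis by blast
    qed
    have "a = b" if a: "a \<in> fst ` F1 \<inter> fst ` F2" and b: "b \<in> fst ` F1 \<inter> fst ` F2" for a b
    proof (rule ccontr)
      assume ab: "a \<noteq> b"
      obtain d e where d: "d \<in> K" "(a, d) \<in> F" "a \<in> V" and e: "e \<in> K" "(b, e) \<in> F" "b \<in> V"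
        using attach[OF a] attach[OF b] by blast
      have "(d, e) \<in> R\<^sup>*"
        using d(1) e(1) symD[OF sym_rtrancl[OF symR], of y d] rtrancl_trans[of d y R e]
        unfolding K_def by simp
      then obtain p where p: "distinct p" "p \<noteq> []" "hd p = d" "last p = e" "darts p \<subseteq> R"
        using rtrancl_darts_path symR by metis
      have pV: "set p \<inter> V = {}"
      proof (cases "2 \<le> length p")
        case True
        then have "set p = fst ` darts p" by (simp add: fst_darts)
        then show ?thesis using p(5) unfolding R_def by auto
      next
        case False
        then have "p = [d]" using p(2,3) by (cases p) (auto simp: Suc_le_eq)
        then show ?thesis using d(1) \<open>K \<inter> V = {}\<close> by auto
      qed
      obtain q where q: "p = d # q" using p by (cases p) auto
      obtain r where r: "p = r @ [e]" using p by (metis append_butlast_last_id)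
      have "darts (a # p @ [b]) = darts [a, d] \<union> darts (p @ [b])"
        unfolding q using darts_join[of "[a]" d "q @ [b]"] by simp
      also have "darts (p @ [b]) = darts p \<union> darts [e, b]"
        unfolding r using darts_join[of r e "[b]"] by simp
      finally have darts: "darts (a # p @ [b]) = darts [a, d] \<union> (darts p \<union> darts [e, b])" .
      have "d \<notin> V" "e \<notin> V" using d e \<open>K \<inter> V = {}\<close> by auto
      moreover have "darts p \<inter> H = {}" using p(5) H_V unfolding R_def by auto
      ultimately have "darts (a # p @ [b]) \<inter> H = {}"
        unfolding darts using H_V[of a d] H_V[of d a] H_V[of e b] H_V[of b e] by auto
      moreover have "darts (a # p @ [b]) \<subseteq> F"
        unfolding darts using d(2) e(2) p(5) symD[OF less.prems(2)] R_def by auto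
      moreover have "distinct (a # p @ [b])" using p(1) pV d(3) e(3) ab by auto
      ultimately show False using no_ear d(3) e(3) pV by blast
    qed
    then have "card (fst ` F1 \<inter> fst ` F2) \<le> 1"
      using card_le_Suc0_iff_eq[of "fst ` F1 \<inter> fst ` F2"] fins(1) unfolding One_nat_def
      by (metis finite_Int finite_imageI)
    moreover have "card (fst ` F1) + card (fst ` F2) = card (fst ` F) + card (fst ` F1 \<inter> fst ` F2)"
      unfolding F12(1) image_Un using fins by (intro card_Un_Int) auto
    \<comment> \<open>The two induction hypotheses add up to 4 g on the left; the vertex counted
      twice uses up 2 g of it.\<close>
    ultimately have "card (fst ` F1) + card (fst ` F2) \<le> card (fst ` F) + 1" by linarith
    then have "2 * g * (card (fst ` F1) + card (fst ` F2)) \<le> 2 * g * (card (fst ` F) + 1)"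
      by (rule mult_le_mono2)
    then show ?thesis using IH unfolding cardF by (simp add: algebra_simps)
  qed
qed

end

subsection \<open>Extending partial colorings\<close>

definition nbs :: "('a \<times> 'a) set \<Rightarrow> 'a set \<Rightarrow> 'a \<Rightarrow> 'a set" where
  "nbs E W x = {y \<in> W. (x, y) \<in> E}"

definition unique_color :: "('a \<Rightarrow> nat) \<Rightarrow> 'a set \<Rightarrow> nat \<Rightarrow> bool" where
  "unique_color c N i \<longleftrightarrow> (\<exists>y\<in>N. c y = i \<and> (\<forall>z\<in>N. c z = i \<longrightarrow> z = y))"

text \<open>All conditions refer to the subgraph induced by W, so they need not pass to subsets of
  W. Bounding the colors, instead of counting them, lets free colors be chosen below k.\<close>

definition pcf_on :: "('a \<times> 'a) set \<Rightarrow> nat \<Rightarrow> 'a set \<Rightarrow> ('a \<Rightarrow> nat) \<Rightarrow> bool" where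
  "pcf_on E k W c \<longleftrightarrow> (\<forall>x\<in>W. c x < k) \<and> (\<forall>x\<in>W. \<forall>y\<in>nbs E W x. c x \<noteq> c y) \<and>
     (\<forall>x\<in>W. nbs E W x \<noteq> {} \<longrightarrow> (\<exists>i. unique_color c (nbs E W x) i))"

lemma in_nbs: "y \<in> nbs E W x \<longleftrightarrow> y \<in> W \<and> (x, y) \<in> E"
  by (simp add: nbs_def)

lemma unique_color_singleton [intro]: "unique_color c {y} (c y)"
  by (simp add: unique_color_def)

lemma unique_color_doubleton: "c x \<noteq> c y \<Longrightarrow> unique_color c {x, y} (c x)"
  by (auto simp: unique_color_def)

lemma ex_color_notin:
  assumes "length xs < k"
  obtains a :: nat where "a < k" "a \<notin> set xs"
proof -
  have "card (set xs) < card {..<k}" using card_length[of xs] assms by simp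
  then have "\<not> {..<k} \<subseteq> set xs" using card_mono[of "set xs" "{..<k}"] by auto
  then show ?thesis using that by auto
qed

text \<open>A unique color around x is the color of a neighbor, hence differs from
  \<open>c x\<close>. Around an isolated vertex any other color is taken. That the mark differs from
  the color is what the thread of four 2-vertices relies on.\<close>

lemma pcf_on_marked_colors:
  assumes "pcf_on E k U c" "2 \<le> k"
  obtains w where "\<And>x. x \<in> U \<Longrightarrow> w x \<noteq> c x" "\<And>x. x \<in> U \<Longrightarrow> w x < k"
    "\<And>x. x \<in> U \<Longrightarrow> nbs E U x \<noteq> {} \<Longrightarrow> unique_color c (nbs E U x) (w x)"
proof -
  have "\<exists>i. i \<noteq> c x \<and> i < k \<and> (nbs E U x \<noteq> {} \<longrightarrow> unique_color c (nbs E U x) i)" if x: "x \<in> U" for x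
  proof (cases "nbs E U x = {}")
    case True
    obtain i where "i < k" "i \<notin> set [c x]" by (rule ex_color_notin[of "[c x]" k]) (use assms in auto)
    with True show ?thesis by auto
  next
    case False
    then obtain y where y: "y \<in> nbs E U x" "unique_color c (nbs E U x) (c y)"
      using assms(1) x unfolding pcf_on_def unique_color_def by metis
    then have "c x \<noteq> c y" "c y < k" using assms(1) x unfolding pcf_on_def by (auto simp: in_nbs)
    with y show ?thesis by (intro exI[of _ "c y"]) auto
  qed
  then show ?thesis using that by metis
qed

text \<open>
  The colors \<open>w x\<close> mark a color occurring exactly once around the old vertex \<open>x\<close>; it stays unique
  if the new neighbors of \<open>x\<close> avoid it.
\<close>

lemma pcf_on_extend:
  assumes sym: "sym E" and SW: "S \<subseteq> W" and c: "pcf_on E k (W - S) c"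
    and w: "\<And>x. x \<in> W - S \<Longrightarrow> nbs E (W - S) x \<noteq> {} \<Longrightarrow> unique_color c (nbs E (W - S) x) (w x)"
    and agree: "\<And>x. x \<in> W - S \<Longrightarrow> c' x = c x"
    and less: "\<And>s. s \<in> S \<Longrightarrow> c' s < k"
    and proper: "\<And>s y. s \<in> S \<Longrightarrow> y \<in> nbs E W s \<Longrightarrow> c' s \<noteq> c' y"
    and marked: "\<And>s y. s \<in> S \<Longrightarrow> y \<in> nbs E W s \<Longrightarrow> y \<notin> S \<Longrightarrow> c' s \<noteq> w y"
    and free: "\<And>s. s \<in> S \<Longrightarrow> nbs E W s \<noteq> {} \<Longrightarrow> \<exists>i. unique_color c' (nbs E W s) i"
    and sparse: "\<And>x s t. x \<in> W - S \<Longrightarrow> s \<in> S \<Longrightarrow> t \<in> S \<Longrightarrow> (s, x) \<in> E \<Longrightarrow> (t, x) \<in> E \<Longrightarrow> s = t"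
  shows "pcf_on E k W c'"
  unfolding pcf_on_def
proof (intro conjI ballI impI)
  fix x assume x: "x \<in> W"
  show "c' x < k"
    using less[of x] agree[of x] c x unfolding pcf_on_def by (cases "x \<in> S") auto
next
  fix x y assume x: "x \<in> W" and y: "y \<in> nbs E W x"
  then have y': "y \<in> W" "(x, y) \<in> E" "(y, x) \<in> E" using sym by (auto simp: in_nbs dest: symD)
  show "c' x \<noteq> c' y"
  proof (cases "x \<in> S \<or> y \<in> S")
    case True
    then show ?thesis using proper[of x y] proper[of y x] x y y' by (auto simp: in_nbs)
  next
    case False
    then have "y \<in> nbs E (W - S) x" "x \<in> W - S" using x y' by (auto simp: in_nbs)
    then show ?thesis using c agree[of x] agree[of y] unfolding pcf_on_def by (auto simp: in_nbs)
  qed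
next
  fix x assume x: "x \<in> W" and ne: "nbs E W x \<noteq> {}"
  show "\<exists>i. unique_color c' (nbs E W x) i"
  proof (cases "x \<in> S")
    case True
    then show ?thesis using free ne by blast
  next
    case False
    then have xWS: "x \<in> W - S" using x by blast
    show ?thesis
    proof (cases "nbs E (W - S) x = {}")
      \<comment> \<open>All neighbors of x are new, and by sparsity there is only one, whose color
        is then trivially unique.\<close>
      case True
      obtain s where s: "s \<in> nbs E W x" using ne by blast
      then have "s \<in> S" using True by (auto simp: in_nbs)
      have "nbs E W x = {s}"
      proof (intro equalityI subsetI)
        fix t assume t: "t \<in> nbs E W x"
        then have "t \<in> S" using True by (auto simp: in_nbs)
        then show "t \<in> {s}" using sparse[OF xWS \<open>t \<in> S\<close> \<open>s \<in> S\<close>] t s sym by (auto simp: in_nbs dest: symD)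
      qed (use s in auto)
      then show ?thesis by auto
    next
      case False
      then obtain y where y: "y \<in> nbs E (W - S) x" "c y = w x"
          "\<And>z. z \<in> nbs E (W - S) x \<Longrightarrow> c z = w x \<Longrightarrow> z = y"
        using w[OF xWS] unfolding unique_color_def by blast
      have "z = y" if z: "z \<in> nbs E W x" "c' z = w x" for z
      proof (cases "z \<in> S")
        case True
        then have "x \<in> nbs E W z" using z x sym by (auto simp: in_nbs dest: symD)
        then show ?thesis using marked[OF True _ \<open>x \<notin> S\<close>] z by blast
      next
        case False
        then have "z \<in> nbs E (W - S) x" "c' z = c z"
          using z(1) agree[of z] by (simp_all add: in_nbs)
        then show ?thesis using y(3) z(2) by simp
      qed
      moreover have "y \<in> nbs E W x" "c' y = w x" using y(1,2) agree[of y] by (simp_all add: in_nbs)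
      ultimately show ?thesis unfolding unique_color_def by blast
    qed
  qed
qed

definition pcf_colorable :: "('a \<times> 'a) set \<Rightarrow> nat \<Rightarrow> 'a set \<Rightarrow> bool" where
  "pcf_colorable E k W \<longleftrightarrow> (\<exists>c. pcf_on E k W c)"

lemma pcf_colorable_marked:
  assumes "pcf_colorable E k U" "2 \<le> k"
  obtains c w where "pcf_on E k U c" "\<And>x. x \<in> U \<Longrightarrow> w x \<noteq> c x"
    "\<And>x. x \<in> U \<Longrightarrow> c x < k" "\<And>x. x \<in> U \<Longrightarrow> w x < k"
    "\<And>x. x \<in> U \<Longrightarrow> nbs E U x \<noteq> {} \<Longrightarrow> unique_color c (nbs E U x) (w x)"
proof -
  obtain c where c: "pcf_on E k U c" using assms(1) unfolding pcf_colorable_def by blast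
  then have less: "c x < k" if "x \<in> U" for x using that unfolding pcf_on_def by blast
  obtain w where "\<And>x. x \<in> U \<Longrightarrow> w x \<noteq> c x" "\<And>x. x \<in> U \<Longrightarrow> w x < k"
    "\<And>x. x \<in> U \<Longrightarrow> nbs E U x \<noteq> {} \<Longrightarrow> unique_color c (nbs E U x) (w x)"
    by (rule pcf_on_marked_colors[OF c assms(2)]) blast
  then show ?thesis using that[OF c _ less] by blast
qed

text \<open>
  The sequence \<open>p, q, a, b, c, d, r, s\<close> has no repetition among three consecutive terms. Here
  \<open>q, r\<close> are the colors of the ends of a thread of four 2-vertices, and \<open>p, s\<close> their marked colors.
\<close>

lemma four_color_thread:
  fixes p q r s :: nat
  assumes "p < 4" "q < 4" "r < 4" "s < 4" "p \<noteq> q" "r \<noteq> s"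
  obtains a b c d where "a < 4" "b < 4" "c < 4" "d < 4"
    "a \<notin> {p, q}" "b \<notin> {q, a}" "c \<notin> {a, b, r}" "d \<notin> {b, c, r, s}"
proof (cases "r \<in> {p, q} \<or> s \<in> {p, q}")
  \<comment> \<open>At most three colors occur among the four given ones, so some color e is free at
    both ends and can serve as both a and d.\<close>
  case True
  then obtain t where t: "{p, q, r, s} = {p, q, t}" by auto
  obtain e where e: "e < 4" "e \<notin> {p, q, r, s}"
    using ex_color_notin[of "[p, q, t]" 4] unfolding t by auto
  obtain b where b: "b < 4" "b \<notin> {q, e}" using ex_color_notin[of "[q, e]" 4] by auto
  obtain c where "c < 4" "c \<notin> {e, b, r}" using ex_color_notin[of "[e, b, r]" 4] by auto
  with e b show ?thesis by (intro that[of e b c e]) auto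
next
  \<comment> \<open>Here p, q, r, s are all four colors, and the sequence becomes p, q, r, p, s, q,
    r, s.\<close>
  case False
  with assms show ?thesis by (intro that[of r p s q]) auto
qed

subsection \<open>Reducible configurations\<close>

text \<open>Excluding short cycles keeps the outer neighbors of a configuration distinct and outside
  of it. Cycles of length 5 are excluded separately, where threads are treated.\<close>

locale sparse_graph =
  fixes E :: "('a \<times> 'a) set"
  assumes sym_E: "sym E" and irrefl_E: "irrefl E"
    and no_triangle: "(a, b) \<in> E \<Longrightarrow> (b, c) \<in> E \<Longrightarrow> (a, c) \<notin> E"
    and no_4cycle: "(a, b) \<in> E \<Longrightarrow> (b, c) \<in> E \<Longrightarrow> (c, d) \<in> E \<Longrightarrow> (d, a) \<in> E \<Longrightarrow> a = c \<or> b = d"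
begin

lemma E_sym: "(x, y) \<in> E \<Longrightarrow> (y, x) \<in> E"
  using sym_E by (auto dest: symD)

lemma E_neq: "(x, y) \<in> E \<Longrightarrow> x \<noteq> y"
  using irrefl_E by (auto simp: irrefl_def)

lemma card_2_nbs:
  assumes "card (nbs E W x) = 2" "y \<in> nbs E W x"
  obtains z where "nbs E W x = {y, z}" "z \<noteq> y" "z \<in> W" "(x, z) \<in> E"
proof -
  obtain p q where pq: "nbs E W x = {p, q}" "p \<noteq> q" using assms(1) by (auto simp: card_2_iff)
  then obtain z where z: "nbs E W x = {y, z}" "z \<noteq> y"
    using assms(2) by (cases "y = p") auto
  then have "z \<in> nbs E W x" by blast
  then have "z \<in> W" "(x, z) \<in> E" unfolding in_nbs by blast+
  then show ?thesis by (rule that[OF z])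
qed

lemma colorable_leaf:
  assumes "x \<in> W" "finite W" "card (nbs E W x) \<le> 1" "3 \<le> k" "pcf_colorable E k (W - {x})"
  shows "pcf_colorable E k W"
proof -
  obtain c w where c: "pcf_on E k (W - {x}) c" "\<And>y. y \<in> W - {x} \<Longrightarrow> nbs E (W - {x}) y \<noteq> {} \<Longrightarrow>
      unique_color c (nbs E (W - {x}) y) (w y)"
    by (rule pcf_colorable_marked[OF assms(5)]) (use assms(4) in auto)
  have "finite (nbs E W x)" using assms(2) by (simp add: nbs_def)
  then obtain u where u: "nbs E W x \<subseteq> {u}"
    using assms(3) by (metis card_le_Suc0_iff_eq One_nat_def singleton_iff subsetI empty_iff ex_in_conv)
  obtain a where a: "a < k" "a \<notin> set [c u, w u]"
    by (rule ex_color_notin[of "[c u, w u]" k]) (use assms(4) in auto)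
  have "pcf_on E k W (c(x := a))"
  proof (rule pcf_on_extend[OF sym_E _ c(1), where w = w])
    show "\<exists>i. unique_color (c(x := a)) (nbs E W s) i" if "s \<in> {x}" "nbs E W s \<noteq> {}" for s
      using that u by (metis singletonD subset_singletonD unique_color_singleton)
    show "(c(x := a)) s \<noteq> (c(x := a)) y" if "s \<in> {x}" "y \<in> nbs E W s" for s y
      using that u a(2) E_neq by (auto simp: in_nbs)
    show "(c(x := a)) s \<noteq> w y" if "s \<in> {x}" "y \<in> nbs E W s" for s y
      using that u a(2) by auto
  qed (use assms(1) a c(2) in auto)
  then show ?thesis unfolding pcf_colorable_def by blast
qed

text \<open>The vertex x avoids \<open>c u\<close>, \<open>w u\<close> and also \<open>c v\<close>,
  so that y sees two colors. Symmetrically y avoids \<open>c v\<close>, \<open>w v\<close> and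
  \<open>c u\<close>, besides the color of x: four colors, hence 5 \<le> k.\<close>

lemma colorable_adjacent_2:
  assumes W: "x \<in> W" "y \<in> W" and nbs: "nbs E W x = {u, y}" "nbs E W y = {x, v}"
    and neq: "u \<noteq> y" "v \<noteq> x" and k: "5 \<le> k" and col: "pcf_colorable E k (W - {x, y})"
  shows "pcf_colorable E k W"
proof -
  have E: "(x, u) \<in> E" "(x, y) \<in> E" "(y, v) \<in> E" "u \<in> W" "v \<in> W" using nbs by (auto simp: nbs_def)
  have neq': "x \<noteq> y" "u \<noteq> x" "v \<noteq> y" "u \<noteq> v"
    using E_neq E no_triangle[of x y v] by auto
  obtain c w where c: "pcf_on E k (W - {x, y}) c" "\<And>z. z \<in> W - {x, y} \<Longrightarrow> nbs E (W - {x, y}) z \<noteq> {} \<Longrightarrow>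
      unique_color c (nbs E (W - {x, y}) z) (w z)"
    by (rule pcf_colorable_marked[OF col]) (use k in auto)
  obtain a where a: "a < k" "a \<notin> set [c u, w u, c v]"
    by (rule ex_color_notin[of "[c u, w u, c v]" k]) (use k in auto)
  obtain b where b: "b < k" "b \<notin> set [c v, w v, c u, a]"
    by (rule ex_color_notin[of "[c v, w v, c u, a]" k]) (use k in auto)
  define c' where "c' = c(x := a, y := b)"
  have c': "c' x = a" "c' y = b" "\<And>z. z \<noteq> x \<Longrightarrow> z \<noteq> y \<Longrightarrow> c' z = c z"
    unfolding c'_def using neq' by auto
  have "pcf_on E k W c'"
  proof (rule pcf_on_extend[OF sym_E _ c(1), where w = w])
    show "c' s \<noteq> c' z" if "s \<in> {x, y}" "z \<in> nbs E W s" for s z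
      using that nbs a b c' neq neq' by auto
    show "c' s \<noteq> w z" if "s \<in> {x, y}" "z \<in> nbs E W s" "z \<notin> {x, y}" for s z
      using that nbs a b c' neq neq' by auto
    have "c' u \<noteq> c' y" "c' x \<noteq> c' v" using a b c' neq neq' by auto
    then show "\<exists>i. unique_color c' (nbs E W s) i" if "s \<in> {x, y}" for s
      using that nbs unique_color_doubleton[of c' u y] unique_color_doubleton[of c' x v] by auto
    show "s = t" if "z \<in> W - {x, y}" "s \<in> {x, y}" "t \<in> {x, y}" "(s, z) \<in> E" "(t, z) \<in> E" for z s t
      using that no_triangle[OF E(2)] by auto
  qed (use W a b c' c(2) in auto)
  then show ?thesis unfolding pcf_colorable_def by blast
qed

text \<open>The vertex v avoids two colors each for p and q, and \<open>c y\<close> for the sake of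
  x: five colors, hence 6 \<le> k. The color of x also avoids \<open>c p\<close>; so around v it is
  unique if p and q agree, and otherwise \<open>c p\<close> is unique.\<close>

lemma colorable_3_with_2_neighbor:
  assumes W: "x \<in> W" "v \<in> W" and nbs: "nbs E W v = {x, p, q}" "nbs E W x = {v, y}"
    and neq: "x \<noteq> p" "x \<noteq> q" "p \<noteq> q" "v \<noteq> y" and k: "6 \<le> k"
    and col: "pcf_colorable E k (W - {x, v})"
  shows "pcf_colorable E k W"
proof -
  have E: "(v, x) \<in> E" "(v, p) \<in> E" "(v, q) \<in> E" "(x, y) \<in> E" using nbs by (auto simp: nbs_def)
  have neq': "x \<noteq> y" "v \<noteq> x" "v \<noteq> p" "v \<noteq> q" "y \<noteq> p" "y \<noteq> q"
    using E_neq E no_triangle[of v x y] by auto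
  obtain c w where c: "pcf_on E k (W - {x, v}) c" "\<And>z. z \<in> W - {x, v} \<Longrightarrow> nbs E (W - {x, v}) z \<noteq> {} \<Longrightarrow>
      unique_color c (nbs E (W - {x, v}) z) (w z)"
    by (rule pcf_colorable_marked[OF col]) (use k in auto)
  obtain a where a: "a < k" "a \<notin> set [c p, w p, c q, w q, c y]"
    by (rule ex_color_notin[of "[c p, w p, c q, w q, c y]" k]) (use k in auto)
  obtain b where b: "b < k" "b \<notin> set [c y, w y, a, c p]"
    by (rule ex_color_notin[of "[c y, w y, a, c p]" k]) (use k in auto)
  define c' where "c' = c(v := a, x := b)"
  have c': "c' v = a" "c' x = b" "\<And>z. z \<noteq> x \<Longrightarrow> z \<noteq> v \<Longrightarrow> c' z = c z"
    unfolding c'_def using neq' by auto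
  have "pcf_on E k W c'"
  proof (rule pcf_on_extend[OF sym_E _ c(1), where w = w])
    show "c' s \<noteq> c' z" if "s \<in> {x, v}" "z \<in> nbs E W s" for s z
      using that nbs a b c' neq neq' by auto
    show "c' s \<noteq> w z" if "s \<in> {x, v}" "z \<in> nbs E W s" "z \<notin> {x, v}" for s z
      using that nbs a b c' neq neq' by auto
    have cf_x: "\<exists>i. unique_color c' (nbs E W x) i"
      using unique_color_doubleton[of c' v y] a c' neq neq' unfolding nbs by auto
    have cf_v: "\<exists>i. unique_color c' (nbs E W v) i"
    proof (cases "c p = c q")
      case True
      then have "unique_color c' {x, p, q} b"
        unfolding unique_color_def using c' b neq neq' by (intro bexI[of _ x]) auto
      then show ?thesis unfolding nbs by blast
    next
      case False
      then have "unique_color c' {x, p, q} (c p)"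
        unfolding unique_color_def using c' b neq neq' by (intro bexI[of _ p]) auto
      then show ?thesis unfolding nbs by blast
    qed
    show "\<exists>i. unique_color c' (nbs E W s) i" if "s \<in> {x, v}" for s
      using that cf_x cf_v by blast
    show "s = t" if "z \<in> W - {x, v}" "s \<in> {x, v}" "t \<in> {x, v}" "(s, z) \<in> E" "(t, z) \<in> E" for z s t
      using that no_triangle[OF E(1)] by auto
  qed (use W a b c' c(2) in auto)
  then show ?thesis unfolding pcf_colorable_def by blast
qed

text \<open>The center avoids the colors of all outer neighbors, at most \<open>card X\<close> many,
  so every leg sees two colors. One leg \<open>x0\<close> gets a color \<alpha> that the other legs
  avoid, which makes \<alpha> unique around v; those legs avoid four colors, hence 5 \<le> k. By the
  absence of 4-cycles the outer neighbors \<open>y x\<close> are distinct, so no old vertex has two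
  new neighbors.\<close>

lemma colorable_2_star:
  assumes W: "v \<in> W" "finite W" and X: "nbs E W v = X" "X \<noteq> {}" "card X < k" "5 \<le> k"
    and two: "\<And>x. x \<in> X \<Longrightarrow> card (nbs E W x) = 2"
    and col: "pcf_colorable E k (W - insert v X)"
  shows "pcf_colorable E k W"
proof -
  have X_E: "(v, x) \<in> E" "(x, v) \<in> E" "x \<in> W" if "x \<in> X" for x
    using that X(1) E_sym by (auto simp: nbs_def)
  have "\<exists>z. nbs E W x = {v, z} \<and> z \<noteq> v" if x: "x \<in> X" for x
    using card_2_nbs[OF two[OF x], of v] X_E[OF x] W(1) by (metis in_nbs)
  then obtain y where y: "\<And>x. x \<in> X \<Longrightarrow> nbs E W x = {v, y x}" "\<And>x. x \<in> X \<Longrightarrow> y x \<noteq> v"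
    by metis
  have y_E: "(x, y x) \<in> E" "y x \<in> W" if "x \<in> X" for x using y(1)[OF that] by (auto simp: nbs_def)
  have y_notin: "y x \<notin> X" if x: "x \<in> X" for x
    using no_triangle[OF X_E(1)[OF x] y_E(1)[OF x]] X_E(1) by blast
  have y_inj: "x = x'" if x: "x \<in> X" and x': "x' \<in> X" and eq: "y x = y x'" for x x'
    using no_4cycle[OF X_E(1)[OF x] y_E(1)[OF x] _ X_E(2)[OF x']] y_E(1)[OF x'] eq y(2)[OF x] E_sym by metis
  have v_notin: "v \<notin> X" using X_E E_neq by blast
  obtain c w where c: "pcf_on E k (W - insert v X) c" "\<And>z. z \<in> W - insert v X \<Longrightarrow>
      nbs E (W - insert v X) z \<noteq> {} \<Longrightarrow> unique_color c (nbs E (W - insert v X) z) (w z)"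
    by (rule pcf_colorable_marked[OF col]) (use X(4) in auto)
  have finX: "finite X" using X(1) W(2) by (auto simp: nbs_def)
  obtain ys where ys: "set ys = (\<lambda>x. c (y x)) ` X" "length ys = card ((\<lambda>x. c (y x)) ` X)"
    using finX by (metis finite_imageI finite_distinct_list distinct_card)
  have "length ys < k" using card_image_le[OF finX, of "\<lambda>x. c (y x)"] ys(2) X(3) by linarith
  then obtain a where a: "a < k" "a \<notin> set ys" by (rule ex_color_notin)
  have a_y: "a \<noteq> c (y x)" if "x \<in> X" for x using a(2) that ys(1) by auto
  obtain x0 where x0: "x0 \<in> X" using X(2) by blast
  obtain \<alpha> where \<alpha>: "\<alpha> < k" "\<alpha> \<notin> set [c (y x0), w (y x0), a]"
    by (rule ex_color_notin[of "[c (y x0), w (y x0), a]" k]) (use X(4) in auto)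
  have "\<exists>b<k. b \<noteq> c (y x) \<and> b \<noteq> w (y x) \<and> b \<noteq> a \<and> (b = \<alpha> \<longleftrightarrow> x = x0)" for x
  proof (cases "x = x0")
    case False
    obtain b where "b < k" "b \<notin> set [c (y x), w (y x), a, \<alpha>]"
      by (rule ex_color_notin[of "[c (y x), w (y x), a, \<alpha>]" k]) (use X(4) in auto)
    with False show ?thesis by auto
  qed (use \<alpha> in auto)
  then obtain f where f: "\<And>x. f x < k" "\<And>x. f x \<noteq> c (y x)" "\<And>x. f x \<noteq> w (y x)" "\<And>x. f x \<noteq> a"
    "\<And>x. f x = \<alpha> \<longleftrightarrow> x = x0"
    by metis
  define c' where "c' z = (if z = v then a else if z \<in> X then f z else c z)" for z
  have c'_v: "c' v = a" by (simp add: c'_def)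
  have c'_X: "c' x = f x" if "x \<in> X" for x using that v_notin by (auto simp: c'_def)
  have c'_y: "c' (y x) = c (y x)" if "x \<in> X" for x using that y_notin y(2) by (simp add: c'_def)
  have "pcf_on E k W c'"
  proof (rule pcf_on_extend[OF sym_E _ c(1), where w = w])
    show "insert v X \<subseteq> W" using X_E W by blast
    show "c' z = c z" if "z \<in> W - insert v X" for z using that by (simp add: c'_def)
    show "c' s < k" if "s \<in> insert v X" for s using that a f(1) by (auto simp: c'_def)
    show "c' s \<noteq> c' z" if s: "s \<in> insert v X" and z: "z \<in> nbs E W s" for s z
    proof (cases "s = v")
      case True
      then have "z \<in> X" using z X(1) by simp
      then show ?thesis using True c'_v c'_X f(4) by metis
    next
      case False
      then have s: "s \<in> X" using s by simp
      then have "z = v \<or> z = y s" using z y(1) by auto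
      then show ?thesis using c'_v c'_X[OF s] c'_y[OF s] f(2,4)[of s] by auto
    qed
    show "c' s \<noteq> w z" if s: "s \<in> insert v X" and z: "z \<in> nbs E W s" "z \<notin> insert v X" for s z
    proof -
      have s: "s \<in> X" using s z X(1) by auto
      then have "z = y s" using z y(1) by auto
      then show ?thesis using c'_X[OF s] f(3) by metis
    qed
    show "\<exists>i. unique_color c' (nbs E W s) i" if s: "s \<in> insert v X" for s
    proof (cases "s = v")
      case True
      have "unique_color c' X \<alpha>"
        unfolding unique_color_def using x0 c'_X f(5) by (intro bexI[of _ x0]) auto
      then show ?thesis using True X(1) by blast
    next
      case False
      then have s: "s \<in> X" using s by simp
      then have "c' v \<noteq> c' (y s)" using c'_v c'_y a_y by metis
      then show ?thesis using y(1)[OF s] unique_color_doubleton by metis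
    qed
    show "s = t" if z: "z \<in> W - insert v X" and s: "s \<in> insert v X" "(s, z) \<in> E"
      and t: "t \<in> insert v X" "(t, z) \<in> E" for z s t
    proof -
      have "(v, z) \<notin> E" using z X(1) by (auto simp: nbs_def)
      then have st: "s \<in> X" "t \<in> X" using s t by auto
      then have "z \<in> nbs E W s" "z \<in> nbs E W t" using z s t by (auto simp: in_nbs)
      then have "z = y s" "z = y t" using y(1)[OF st(1)] y(1)[OF st(2)] z by auto
      then show ?thesis using y_inj st by blast
    qed
  qed (use c(2) in auto)
  then show ?thesis unfolding pcf_colorable_def by blast
qed

text \<open>A 2-vertex is conflict-free once its two neighbors differ, so the demands along the
  thread are those of \<open>four_color_thread\<close>. Triangles and 4-cycles being excluded, the
  six vertices are distinct; the 5-cycle is excluded by u \<noteq> v.\<close>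

lemma colorable_thread:
  assumes W: "x1 \<in> W" "x2 \<in> W" "x3 \<in> W" "x4 \<in> W"
    and nbs: "nbs E W x1 = {u, x2}" "nbs E W x2 = {x1, x3}" "nbs E W x3 = {x2, x4}" "nbs E W x4 = {x3, v}"
    and neq: "u \<noteq> x2" "x1 \<noteq> x3" "x2 \<noteq> x4" "v \<noteq> x3" "u \<noteq> v"
    and col: "pcf_colorable E 4 (W - {x1, x2, x3, x4})"
  shows "pcf_colorable E 4 W"
proof -
  have E: "(x1, u) \<in> E" "(x1, x2) \<in> E" "(x2, x3) \<in> E" "(x3, x4) \<in> E" "(x4, v) \<in> E" "u \<in> W" "v \<in> W"
    using nbs by (auto simp: nbs_def)
  have sides: "x1 \<noteq> x2" "x2 \<noteq> x3" "x3 \<noteq> x4" "u \<noteq> x1" "v \<noteq> x4"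
    using E E_neq by blast+
  have "x1 \<noteq> x4" "u \<noteq> x3" "v \<noteq> x2"
    using no_triangle[OF E(2,3)] no_triangle[OF E(3,4)] E E_sym by blast+
  moreover have "(x4, x1) \<notin> E" using no_4cycle[OF E(2,3,4)] neq by blast
  then have "u \<noteq> x4" "v \<noteq> x1" using E E_sym by blast+
  ultimately have neq': "x1 \<noteq> x4" "u \<noteq> x3" "v \<noteq> x2" "u \<noteq> x4" "v \<noteq> x1" by blast+
  let ?S = "{x1, x2, x3, x4}"
  have uv: "u \<in> W - ?S" "v \<in> W - ?S" using E neq sides neq' by auto
  obtain c w where c: "pcf_on E 4 (W - ?S) c" "\<And>x. x \<in> W - ?S \<Longrightarrow> w x \<noteq> c x"
    "\<And>x. x \<in> W - ?S \<Longrightarrow> c x < 4" "\<And>x. x \<in> W - ?S \<Longrightarrow> w x < 4"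
    "\<And>z. z \<in> W - ?S \<Longrightarrow> nbs E (W - ?S) z \<noteq> {} \<Longrightarrow> unique_color c (nbs E (W - ?S) z) (w z)"
    by (rule pcf_colorable_marked[OF col]) (simp, blast)
  obtain c1 c2 c3 c4 where col: "c1 < 4" "c2 < 4" "c3 < 4" "c4 < 4"
    "c1 \<notin> {w u, c u}" "c2 \<notin> {c u, c1}" "c3 \<notin> {c1, c2, c v}" "c4 \<notin> {c2, c3, c v, w v}"
    by (rule four_color_thread[of "w u" "c u" "c v" "w v"])
      (use c(2)[OF uv(1)] c(2)[OF uv(2)] c(3,4)[OF uv(1)] c(3,4)[OF uv(2)] in auto)
  define c' where "c' = c(x1 := c1, x2 := c2, x3 := c3, x4 := c4)"
  have c'x: "c' x1 = c1" "c' x2 = c2" "c' x3 = c3" "c' x4 = c4"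
    unfolding c'_def using neq neq' sides by auto
  have c'_out: "c' z = c z" if "z \<notin> ?S" for z using that unfolding c'_def by auto
  have c'uv: "c' u = c u" "c' v = c v" using c'_out uv by blast+
  have "pcf_on E 4 W c'"
  proof (rule pcf_on_extend[OF sym_E _ c(1), where w = w])
    show "c' s \<noteq> c' z" if "s \<in> ?S" "z \<in> nbs E W s" for s z
      using that nbs col c'x c'uv by auto
    show "c' s \<noteq> w z" if "s \<in> ?S" "z \<in> nbs E W s" "z \<notin> ?S" for s z
      using that nbs col c'x c'uv by auto
    have "c' u \<noteq> c' x2" "c' x1 \<noteq> c' x3" "c' x2 \<noteq> c' x4" "c' x3 \<noteq> c' v"
      using col c'x c'uv by auto
    then have "\<exists>i. unique_color c' (nbs E W x1) i" "\<exists>i. unique_color c' (nbs E W x2) i"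
        "\<exists>i. unique_color c' (nbs E W x3) i" "\<exists>i. unique_color c' (nbs E W x4) i"
      unfolding nbs by (meson unique_color_doubleton)+
    then show "\<exists>i. unique_color c' (nbs E W s) i" if "s \<in> ?S" for s
      using that by blast
    show "s = t" if z: "z \<in> W - ?S" and s: "s \<in> ?S" "(s, z) \<in> E" and t: "t \<in> ?S" "(t, z) \<in> E" for z s t
    proof -
      have "r = x1 \<and> z = u \<or> r = x4 \<and> z = v" if r: "r \<in> ?S" "(r, z) \<in> E" for r
      proof -
        have "z \<in> nbs E W r" using z r(2) by (simp add: in_nbs)
        then show ?thesis using r(1) z nbs by auto
      qed
      from this[OF s] this[OF t] show ?thesis using neq(5) by auto
    qed
    show "c' z = c z" if "z \<in> W - ?S" for z using that c'_out by blast
    show "c' s < 4" if "s \<in> ?S" for s using that col c'x by auto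
    show "?S \<subseteq> W" using W by simp
  qed (use c(5) in auto)
  then show ?thesis unfolding pcf_colorable_def by blast
qed

end

subsection \<open>Discharging\<close>

context sparse_graph
begin

text \<open>All proper subsets are required to be colorable, since whole configurations are removed
  and colorability does not pass to subsets: a 5-cycle needs five colors, but four suffice after a
  leaf is attached to each of its vertices.\<close>

definition critical :: "nat \<Rightarrow> 'a set \<Rightarrow> bool" where
  "critical k W \<longleftrightarrow> finite W \<and> \<not> pcf_colorable E k W \<and> (\<forall>U. U \<subset> W \<longrightarrow> pcf_colorable E k U)"

lemma criticalD:
  assumes "critical k W"
  shows "finite W" "\<not> pcf_colorable E k W" "S \<subseteq> W \<Longrightarrow> S \<noteq> {} \<Longrightarrow> pcf_colorable E k (W - S)"
proof -
  show "finite W" "\<not> pcf_colorable E k W" using assms unfolding critical_def by auto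
  assume "S \<subseteq> W" "S \<noteq> {}"
  then have "W - S \<subset> W" by auto
  then show "pcf_colorable E k (W - S)" using assms unfolding critical_def by blast
qed

lemma finite_nbs: "finite W \<Longrightarrow> finite (nbs E W x)"
  by (simp add: nbs_def)

lemma sum_card_nbs:
  assumes "finite W"
  shows "(\<Sum>x\<in>W. card (nbs E W x)) = card (E \<inter> W \<times> W)"
proof -
  have "E \<inter> W \<times> W = Sigma W (nbs E W)" by (auto simp: nbs_def)
  then show ?thesis using assms finite_nbs by (simp add: card_SigmaI)
qed

lemma critical_min_degree:
  assumes "critical k W" "3 \<le> k" "x \<in> W"
  shows "2 \<le> card (nbs E W x)"
proof (rule ccontr)
  assume "\<not> 2 \<le> card (nbs E W x)"
  then have "card (nbs E W x) \<le> 1" by simp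
  then have "pcf_colorable E k W"
    using colorable_leaf[OF assms(3) _ _ assms(2)] criticalD[OF assms(1)] assms(3) by simp
  then show False using criticalD(2)[OF assms(1)] by blast
qed

lemma critical_no_adjacent_2:
  assumes "critical k W" "5 \<le> k" "x \<in> W" "y \<in> W" "(x, y) \<in> E" "card (nbs E W x) = 2"
  shows "card (nbs E W y) \<noteq> 2"
proof
  assume y2: "card (nbs E W y) = 2"
  have yx: "y \<in> nbs E W x" "x \<in> nbs E W y" using assms E_sym by (auto simp: in_nbs)
  obtain u where u: "nbs E W x = {y, u}" "u \<noteq> y" using card_2_nbs[OF assms(6) yx(1)] by blast
  obtain v where v: "nbs E W y = {x, v}" "v \<noteq> x" using card_2_nbs[OF y2 yx(2)] by blast
  have "nbs E W x = {u, y}" using u(1) by blast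
  moreover have "pcf_colorable E k (W - {x, y})"
    by (rule criticalD(3)[OF assms(1)]) (use assms in auto)
  ultimately have "pcf_colorable E k W"
    using colorable_adjacent_2[OF assms(3,4) _ v(1) u(2) v(2) assms(2)] by blast
  then show False using criticalD(2)[OF assms(1)] by blast
qed

definition nbs2 :: "'a set \<Rightarrow> 'a \<Rightarrow> 'a set" where
  "nbs2 W y = {x \<in> nbs E W y. card (nbs E W x) = 2}"

lemma card_nbs2_le: "finite W \<Longrightarrow> card (nbs2 W y) \<le> card (nbs E W y)"
  unfolding nbs2_def by (intro card_mono finite_nbs) auto

lemma critical_2_star:
  assumes "critical k W" "5 \<le> k" "y \<in> W" "card (nbs E W y) < k"
  shows "card (nbs2 W y) < card (nbs E W y)"
proof (rule ccontr)
  note fin = criticalD(1)[OF assms(1)]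
  assume "\<not> card (nbs2 W y) < card (nbs E W y)"
  then have "card (nbs2 W y) = card (nbs E W y)" using card_nbs2_le[OF fin, of y] by simp
  then have "nbs2 W y = nbs E W y"
    using finite_nbs[OF fin, of y] by (intro card_subset_eq) (auto simp: nbs2_def)
  then have two: "card (nbs E W x) = 2" if "x \<in> nbs E W y" for x
    using that unfolding nbs2_def by blast
  have "2 \<le> card (nbs E W y)" using critical_min_degree[OF assms(1) _ assms(3)] assms(2) by simp
  then have ne: "nbs E W y \<noteq> {}" by auto
  have "insert y (nbs E W y) \<subseteq> W" using assms(3) by (auto simp: nbs_def)
  then have "pcf_colorable E k (W - insert y (nbs E W y))"
    by (intro criticalD(3)[OF assms(1)]) auto
  then have "pcf_colorable E k W"
    using colorable_2_star[OF assms(3) fin refl ne assms(4,2) two] by blast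
  then show False using criticalD(2)[OF assms(1)] by blast
qed

lemma critical_3_no_2_neighbor:
  assumes "critical k W" "6 \<le> k" "v \<in> W" "card (nbs E W v) = 3"
  shows "nbs2 W v = {}"
proof (rule ccontr)
  assume "nbs2 W v \<noteq> {}"
  then obtain x where x: "x \<in> nbs E W v" "card (nbs E W x) = 2" unfolding nbs2_def by blast
  have "card (nbs E W v - {x}) = 2"
    using assms(4) x(1) finite_nbs[OF criticalD(1)[OF assms(1)], of v] by simp
  then obtain p q where pq: "nbs E W v - {x} = {p, q}" "p \<noteq> q" by (auto simp: card_2_iff)
  have v: "nbs E W v = {x, p, q}" "x \<noteq> p" "x \<noteq> q" using pq(1) x(1) by auto
  have "x \<in> W" "v \<in> nbs E W x" using x(1) assms(3) E_sym by (auto simp: in_nbs)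
  obtain y where y: "nbs E W x = {v, y}" "y \<noteq> v" using card_2_nbs[OF x(2) \<open>v \<in> nbs E W x\<close>] by blast
  have "pcf_colorable E k (W - {x, v})"
    by (rule criticalD(3)[OF assms(1)]) (use assms \<open>x \<in> W\<close> in auto)
  then have "pcf_colorable E k W"
    using colorable_3_with_2_neighbor[OF \<open>x \<in> W\<close> assms(3) v(1) y(1) v(2,3) pq(2) y(2)[symmetric] assms(2)]
    by blast
  then show False using criticalD(2)[OF assms(1)] by blast
qed

text \<open>Double counting of edges at 2-vertices: no two 2-vertices are adjacent, so both
  neighbors of each have degree at least 3.\<close>

lemma critical_sum_nbs2:
  assumes "critical k W" "5 \<le> k"
  shows "(\<Sum>y\<in>{y \<in> W. 3 \<le> card (nbs E W y)}. card (nbs2 W y)) = 2 * card {x \<in> W. card (nbs E W x) = 2}"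
proof -
  let ?N2 = "{x \<in> W. card (nbs E W x) = 2}" and ?N3 = "{y \<in> W. 3 \<le> card (nbs E W y)}"
  have fin: "finite ?N2" "finite ?N3" using criticalD(1)[OF assms(1)] by auto
  have N2: "{y \<in> ?N3. (y, x) \<in> E} = nbs E W x" if x: "x \<in> ?N2" for x
  proof -
    have "3 \<le> card (nbs E W y)" if y: "y \<in> nbs E W x" for y
    proof -
      have "card (nbs E W y) \<noteq> 2" "2 \<le> card (nbs E W y)"
        using critical_no_adjacent_2[OF assms, of x y] critical_min_degree[OF assms(1), of y] assms(2) x y
        by (auto simp: in_nbs)
      then show ?thesis by linarith
    qed
    then show ?thesis using E_sym by (auto simp: in_nbs)
  qed
  have "(\<Sum>y\<in>?N3. card {x \<in> ?N2. (y, x) \<in> E}) = (\<Sum>x\<in>?N2. 2)"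
    by (rule sum_multicount_gen[OF fin(2,1)]) (use N2 in auto)
  moreover have "{x \<in> ?N2. (y, x) \<in> E} = nbs2 W y" for y
    by (auto simp: nbs2_def in_nbs)
  ultimately show ?thesis by simp
qed

lemma degree_split:
  assumes "critical k W" "3 \<le> k"
  shows "(\<Sum>x\<in>W. f x) = (\<Sum>x\<in>{x \<in> W. card (nbs E W x) = 2}. f x) +
      (\<Sum>x\<in>{x \<in> W. 3 \<le> card (nbs E W x)}. (f x :: nat))"
    "card W = card {x \<in> W. card (nbs E W x) = 2} + card {x \<in> W. 3 \<le> card (nbs E W x)}"
proof -
  let ?N2 = "{x \<in> W. card (nbs E W x) = 2}" and ?N3 = "{x \<in> W. 3 \<le> card (nbs E W x)}"
  have fin: "finite ?N2" "finite ?N3" using criticalD(1)[OF assms(1)] by auto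
  have "x \<in> ?N2 \<union> ?N3" if x: "x \<in> W" for x
    using critical_min_degree[OF assms x] x by (cases "card (nbs E W x) = 2") auto
  then have W: "W = ?N2 \<union> ?N3" by blast
  have disj: "?N2 \<inter> ?N3 = {}" by auto
  show "(\<Sum>x\<in>W. f x) = (\<Sum>x\<in>?N2. f x) + (\<Sum>x\<in>?N3. f x)"
    using sum.union_disjoint[OF fin disj, of f] W by simp
  show "card W = card ?N2 + card ?N3"
    using card_Un_disjoint[OF fin disj] W by simp
qed

text \<open>A vertex of degree d has charge 5 d and needs 14. A 2-vertex lacks 4 and receives 2 from
  each of its neighbors.\<close>

lemma critical_6_dense:
  assumes "critical 6 W"
  shows "14 * card W \<le> 5 * card (E \<inter> W \<times> W)"
proof -
  let ?N2 = "{x \<in> W. card (nbs E W x) = 2}" and ?N3 = "{x \<in> W. 3 \<le> card (nbs E W x)}"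
  have fin: "finite W" using criticalD(1)[OF assms] .
  \<comment> \<open>Degree 3 gives nothing away (14 \<le> 15), degree 4 serves at most three
    2-vertices (20 \<le> 20), and from degree 5 on 14 + 2 d \<le> 5 d.\<close>
  have charge: "14 + 2 * card (nbs2 W y) \<le> 5 * card (nbs E W y)" if y: "y \<in> ?N3" for y
  proof -
    consider "card (nbs E W y) = 3" | "card (nbs E W y) = 4" | "5 \<le> card (nbs E W y)"
      using y by force
    then show ?thesis
    proof cases
      case 1
      then show ?thesis using critical_3_no_2_neighbor[OF assms _ _ 1] y by simp
    next
      case 2
      then show ?thesis using critical_2_star[OF assms, of y] y by simp
    next
      case 3
      then show ?thesis using card_nbs2_le[OF fin, of y] by linarith
    qed
  qed
  have "5 * card (E \<inter> W \<times> W) = (\<Sum>x\<in>W. 5 * card (nbs E W x))"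
    by (simp add: sum_card_nbs[OF fin, symmetric] sum_distrib_left)
  also have "\<dots> = (\<Sum>x\<in>?N2. 5 * card (nbs E W x)) + (\<Sum>x\<in>?N3. 5 * card (nbs E W x))"
    by (rule degree_split[OF assms]) simp
  also have "(\<Sum>x\<in>?N2. 5 * card (nbs E W x)) = (\<Sum>x\<in>?N2. 10)"
    by (rule sum.cong) auto
  finally have total: "5 * card (E \<inter> W \<times> W) = 10 * card ?N2 + (\<Sum>x\<in>?N3. 5 * card (nbs E W x))"
    by simp
  have "(\<Sum>x\<in>?N3. 14 + 2 * card (nbs2 W x)) \<le> (\<Sum>x\<in>?N3. 5 * card (nbs E W x))"
    by (rule sum_mono) (rule charge)
  moreover have "(\<Sum>x\<in>?N3. 14 + 2 * card (nbs2 W x)) = 14 * card ?N3 + 4 * card ?N2"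
    using critical_sum_nbs2[OF assms] by (simp add: sum.distrib flip: sum_distrib_left)
  ultimately show ?thesis
    using total degree_split(2)[OF assms] by simp
qed

text \<open>The inequality is doubled so that all shares are integers: charge 4 d against the demand
  10. A 2-vertex lacks 2 and receives 1 from each neighbor; a vertex of degree 3 with two such
  neighbors is tight.\<close>

lemma critical_5_dense:
  assumes "critical 5 W"
  shows "5 * card W \<le> 2 * card (E \<inter> W \<times> W)"
proof -
  let ?N2 = "{x \<in> W. card (nbs E W x) = 2}" and ?N3 = "{x \<in> W. 3 \<le> card (nbs E W x)}"
  have fin: "finite W" using criticalD(1)[OF assms] .
  have charge: "10 + card (nbs2 W y) \<le> 4 * card (nbs E W y)" if y: "y \<in> ?N3" for y
  proof (cases "card (nbs E W y) = 3")
    case True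
    then show ?thesis using critical_2_star[OF assms, of y] y by simp
  next
    case False
    then have "4 \<le> card (nbs E W y)" using y by auto
    then show ?thesis using card_nbs2_le[OF fin, of y] by linarith
  qed
  have "4 * card (E \<inter> W \<times> W) = (\<Sum>x\<in>W. 4 * card (nbs E W x))"
    by (simp add: sum_card_nbs[OF fin, symmetric] sum_distrib_left)
  also have "\<dots> = (\<Sum>x\<in>?N2. 4 * card (nbs E W x)) + (\<Sum>x\<in>?N3. 4 * card (nbs E W x))"
    by (rule degree_split[OF assms]) simp
  also have "(\<Sum>x\<in>?N2. 4 * card (nbs E W x)) = (\<Sum>x\<in>?N2. 8)"
    by (rule sum.cong) auto
  finally have total: "4 * card (E \<inter> W \<times> W) = 8 * card ?N2 + (\<Sum>x\<in>?N3. 4 * card (nbs E W x))"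
    by simp
  have "(\<Sum>x\<in>?N3. 10 + card (nbs2 W x)) \<le> (\<Sum>x\<in>?N3. 4 * card (nbs E W x))"
    by (rule sum_mono) (rule charge)
  moreover have "(\<Sum>x\<in>?N3. 10 + card (nbs2 W x)) = 10 * card ?N3 + 2 * card ?N2"
    using critical_sum_nbs2[OF assms] by (simp add: sum.distrib flip: sum_distrib_left)
  ultimately show ?thesis
    using total degree_split(2)[OF assms] by simp
qed

text \<open>
  For the bound 24/11, every 2-vertex must receive charge from vertices of degree at least 3 along
  the thread containing it. Each of its two darts is traced back to the dart that enters the thread;
  as threads have at most three vertices, this takes at most three steps.
\<close>

definition darts2 :: "'a set \<Rightarrow> ('a \<times> 'a) set" where
  "darts2 W = {(x, y) \<in> E \<inter> W \<times> W. card (nbs E W x) = 2}"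

definition continue_darts :: "'a set \<Rightarrow> ('a \<times> 'a) set \<Rightarrow> ('a \<times> 'a) set" where
  "continue_darts W A = {(x, y) \<in> darts2 W. \<exists>z. z \<noteq> y \<and> (z, x) \<in> A}"

text \<open>A 2-vertex entered from z has exactly one other neighbor, so continuing is a function of
  the entering dart.\<close>

lemma card_continue_darts_le:
  assumes "finite W" "A \<subseteq> E \<inter> W \<times> W"
  shows "card (continue_darts W A) \<le> card A"
proof -
  have "continue_darts W A \<subseteq> (\<lambda>(z, x). (x, THE y. y \<in> nbs E W x \<and> y \<noteq> z)) ` A"
  proof clarify
    fix x y assume "(x, y) \<in> continue_darts W A"
    then obtain z where z: "z \<noteq> y" "(z, x) \<in> A" and x: "(x, y) \<in> E" "x \<in> W" "y \<in> W" "card (nbs E W x) = 2"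
      unfolding continue_darts_def darts2_def by blast
    have "z \<in> nbs E W x" using z(2) assms(2) E_sym by (auto simp: in_nbs)
    then obtain y' where y': "nbs E W x = {z, y'}" "y' \<noteq> z" using card_2_nbs[OF x(4)] by blast
    have "y \<in> nbs E W x" using x by (simp add: in_nbs)
    then have "y = y'" using y' z(1) by auto
    then have "(THE y. y \<in> nbs E W x \<and> y \<noteq> z) = y" using y' by (intro the_equality) auto
    then show "(x, y) \<in> (\<lambda>(z, x). (x, THE y. y \<in> nbs E W x \<and> y \<noteq> z)) ` A"
      using z(2) by (intro image_eqI[of _ _ "(z, x)"]) auto
  qed
  moreover have "finite A" using assms finite_subset by blast
  ultimately show ?thesis by (meson surj_card_le)
qed

lemma critical_4_darts2:
  assumes crit: "critical 4 W"
    and no_5cycle: "\<And>a b c d e. (a, b) \<in> E \<Longrightarrow> (b, c) \<in> E \<Longrightarrow> (c, d) \<in> E \<Longrightarrow> (d, e) \<in> E \<Longrightarrow> (e, a) \<notin> E"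
    and xy: "(x, y) \<in> darts2 W"
  defines "A \<equiv> {(x, y) \<in> E \<inter> W \<times> W. 3 \<le> card (nbs E W x)}"
  shows "(x, y) \<in> continue_darts W A \<or> (x, y) \<in> continue_darts W (continue_darts W A) \<or>
    (x, y) \<in> continue_darts W (continue_darts W (continue_darts W A))"
proof (rule ccontr)
  \<comment> \<open>Then x and the three vertices found by tracing back are all 2-vertices: a
    reducible thread of four with ends y and v.\<close>
  assume none: "\<not> ?thesis"
  have prev: "\<exists>z. (z, x) \<in> E \<inter> W \<times> W \<and> z \<noteq> y \<and> nbs E W x = {y, z} \<and>
      ((z, x) \<in> A \<or> (z, x) \<in> darts2 W)" if xy: "(x, y) \<in> darts2 W" for x y
  proof -
    have xy': "x \<in> W" "y \<in> W" "y \<in> nbs E W x" "card (nbs E W x) = 2"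
      using xy unfolding darts2_def by (auto simp: in_nbs)
    then obtain z where z: "nbs E W x = {y, z}" "z \<noteq> y" "z \<in> W" "(x, z) \<in> E"
      using card_2_nbs[OF xy'(4,3)] by blast
    then have zx: "(z, x) \<in> E \<inter> W \<times> W" using E_sym xy' by auto
    have "2 \<le> card (nbs E W z)" using critical_min_degree[OF crit] z(3) by simp
    then have "card (nbs E W z) = 2 \<or> 3 \<le> card (nbs E W z)" by linarith
    then have "(z, x) \<in> A \<or> (z, x) \<in> darts2 W" using zx unfolding A_def darts2_def by auto
    with z zx show ?thesis by blast
  qed
  have cont: "(x, y) \<in> continue_darts W B" if "(x, y) \<in> darts2 W" "z \<noteq> y" "(z, x) \<in> B" for x y z B
    using that unfolding continue_darts_def by blast
  obtain x2 where x2: "(x2, x) \<in> E \<inter> W \<times> W" "x2 \<noteq> y" "nbs E W x = {y, x2}" "(x2, x) \<in> A \<or> (x2, x) \<in> darts2 W"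
    using prev[OF xy] by blast
  have "(x2, x) \<notin> A" using cont[OF xy x2(2)] none by blast
  then have x2': "(x2, x) \<in> darts2 W" using x2(4) by blast
  obtain x3 where x3: "(x3, x2) \<in> E \<inter> W \<times> W" "x3 \<noteq> x" "nbs E W x2 = {x, x3}" "(x3, x2) \<in> A \<or> (x3, x2) \<in> darts2 W"
    using prev[OF x2'] by blast
  have "(x3, x2) \<notin> A" using cont[OF x2' x3(2), THEN cont[OF xy x2(2)]] none by blast
  then have x3': "(x3, x2) \<in> darts2 W" using x3(4) by blast
  obtain x4 where x4: "(x4, x3) \<in> E \<inter> W \<times> W" "x4 \<noteq> x2" "nbs E W x3 = {x2, x4}" "(x4, x3) \<in> A \<or> (x4, x3) \<in> darts2 W"
    using prev[OF x3'] by blast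
  have "(x4, x3) \<notin> A"
    using cont[OF x3' x4(2), THEN cont[OF x2' x3(2)], THEN cont[OF xy x2(2)]] none by blast
  then have x4': "(x4, x3) \<in> darts2 W" using x4(4) by blast
  obtain v where v: "(v, x4) \<in> E \<inter> W \<times> W" "v \<noteq> x3" "nbs E W x4 = {x3, v}"
    using prev[OF x4'] by blast
  have W: "x \<in> W" "x2 \<in> W" "x3 \<in> W" "x4 \<in> W" using x2(1) x3(1) x4(1) by auto
  have "y \<noteq> v"
  proof
    assume "y = v"
    then have "(y, x4) \<in> E" "(x4, x3) \<in> E" "(x3, x2) \<in> E" "(x2, x) \<in> E" "(x, y) \<in> E"
      using x2(1) x3(1) x4(1) v(1) xy unfolding darts2_def by auto
    then show False using no_5cycle by blast
  qed
  moreover have "pcf_colorable E 4 (W - {x, x2, x3, x4})"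
    by (rule criticalD(3)[OF crit]) (use W in auto)
  ultimately have "pcf_colorable E 4 W"
    using colorable_thread[OF W x2(3) x3(3) x4(3) v(3) x2(2)[symmetric] x3(2)[symmetric] x4(2)[symmetric] v(2)]
    by blast
  then show False using criticalD(2)[OF crit] by blast
qed

text \<open>Charge 11 d against the demand 24: a 2-vertex lacks 2, that is 1 for each of its darts.
  A dart leaving a vertex of degree d \<ge> 3 pays 1 to each of at most three darts, and 24 + 3 d
  \<le> 11 d, with equality for d = 3.\<close>

lemma critical_4_dense:
  assumes crit: "critical 4 W"
    and no_5cycle: "\<And>a b c d e. (a, b) \<in> E \<Longrightarrow> (b, c) \<in> E \<Longrightarrow> (c, d) \<in> E \<Longrightarrow> (d, e) \<in> E \<Longrightarrow> (e, a) \<notin> E"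
  shows "24 * card W \<le> 11 * card (E \<inter> W \<times> W)"
proof -
  let ?N2 = "{x \<in> W. card (nbs E W x) = 2}" and ?N3 = "{x \<in> W. 3 \<le> card (nbs E W x)}"
  define A where "A = {(x, y) \<in> E \<inter> W \<times> W. 3 \<le> card (nbs E W x)}"
  define B1 where "B1 = continue_darts W A"
  define B2 where "B2 = continue_darts W B1"
  define B3 where "B3 = continue_darts W B2"
  have fin: "finite W" using criticalD(1)[OF crit] .
  have cont_sub: "continue_darts W B \<subseteq> E \<inter> W \<times> W" for B
    unfolding continue_darts_def darts2_def by blast
  have "finite (E \<inter> W \<times> W)" using fin by simp
  then have fins: "finite B1" "finite B2" "finite B3"
    unfolding B1_def B2_def B3_def using cont_sub finite_subset by blast+
  have "darts2 W \<subseteq> B1 \<union> B2 \<union> B3"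
  proof (rule subrelI)
    fix x y assume xy: "(x, y) \<in> darts2 W"
    have "(x, y) \<in> B1 \<or> (x, y) \<in> B2 \<or> (x, y) \<in> B3"
      unfolding B3_def B2_def B1_def A_def
      by (rule critical_4_darts2[OF crit]) (use no_5cycle xy in blast)+
    then show "(x, y) \<in> B1 \<union> B2 \<union> B3" by blast
  qed
  then have "card (darts2 W) \<le> card (B1 \<union> B2 \<union> B3)" using fins by (intro card_mono) auto
  also have "\<dots> \<le> card B1 + card B2 + card B3"
    using card_Un_le[of "B1 \<union> B2" B3] card_Un_le[of B1 B2] by linarith
  also have "\<dots> \<le> 3 * card A"
  proof -
    have "card B1 \<le> card A" unfolding B1_def by (rule card_continue_darts_le[OF fin]) (auto simp: A_def)
    moreover have "card B2 \<le> card B1"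
      unfolding B2_def by (rule card_continue_darts_le[OF fin]) (unfold B1_def, rule cont_sub)
    moreover have "card B3 \<le> card B2"
      unfolding B3_def by (rule card_continue_darts_le[OF fin]) (unfold B2_def, rule cont_sub)
    ultimately show ?thesis by linarith
  qed
  also have "card A = (\<Sum>x\<in>?N3. card (nbs E W x))"
  proof -
    have "A = Sigma ?N3 (nbs E W)" by (auto simp: A_def nbs_def)
    then show ?thesis using fin finite_nbs by (simp add: card_SigmaI)
  qed
  finally have "card (darts2 W) \<le> 3 * (\<Sum>x\<in>?N3. card (nbs E W x))" .
  moreover have "card (darts2 W) = 2 * card ?N2"
  proof -
    have "darts2 W = Sigma ?N2 (nbs E W)" by (auto simp: darts2_def nbs_def)
    then show ?thesis using fin finite_nbs by (simp add: card_SigmaI)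
  qed
  ultimately have charge: "2 * card ?N2 \<le> 3 * (\<Sum>x\<in>?N3. card (nbs E W x))" by simp
  have "11 * card (E \<inter> W \<times> W) = (\<Sum>x\<in>W. 11 * card (nbs E W x))"
    by (simp add: sum_card_nbs[OF fin, symmetric] sum_distrib_left)
  also have "\<dots> = (\<Sum>x\<in>?N2. 11 * card (nbs E W x)) + (\<Sum>x\<in>?N3. 11 * card (nbs E W x))"
    by (rule degree_split[OF crit]) simp
  also have "(\<Sum>x\<in>?N2. 11 * card (nbs E W x)) = (\<Sum>x\<in>?N2. 22)"
    by (rule sum.cong) auto
  finally have total: "11 * card (E \<inter> W \<times> W) = 22 * card ?N2 + (\<Sum>x\<in>?N3. 11 * card (nbs E W x))"
    by simp
  have "(\<Sum>x\<in>?N3. 24 + 3 * card (nbs E W x)) \<le> (\<Sum>x\<in>?N3. 11 * card (nbs E W x))"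
    by (rule sum_mono) auto
  moreover have "(\<Sum>x\<in>?N3. 24 + 3 * card (nbs E W x)) = 24 * card ?N3 + 3 * (\<Sum>x\<in>?N3. card (nbs E W x))"
    by (simp add: sum.distrib flip: sum_distrib_left)
  ultimately show ?thesis
    using total charge degree_split(2)[OF crit] by simp
qed

lemma colorable_if_no_critical:
  assumes "finite V" "\<And>W. W \<subseteq> V \<Longrightarrow> W \<noteq> {} \<Longrightarrow> \<not> critical k W"
  shows "pcf_colorable E k V"
  using assms
proof (induction V rule: finite_psubset_induct)
  case (psubset V)
  have "pcf_colorable E k U" if "U \<subset> V" for U
    using psubset.IH[OF that] psubset.prems that by (meson psubset_imp_subset subset_trans)
  then have "pcf_colorable E k V" if "V \<noteq> {}"
    using psubset.prems[of V] psubset.hyps that unfolding critical_def by blast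
  moreover have "pcf_colorable E k {}" by (simp add: pcf_colorable_def pcf_on_def)
  ultimately show ?case by blast
qed

end

subsection \<open>Planar graphs of large girth\<close>

lemma pair_graph_arcs:
  assumes "pair_graph G"
  shows "finite (pverts G)" "finite (parcs G)" "sym (parcs G)" "irrefl (parcs G)"
    "(u, v) \<in> parcs G \<Longrightarrow> u \<in> pverts G" "(u, v) \<in> parcs G \<Longrightarrow> v \<in> pverts G"
proof -
  interpret pair_graph G by fact
  show "finite (pverts G)" "finite (parcs G)" by (rule pair_finite_verts pair_finite_arcs)+
  show "sym (parcs G)" using pair_sym_arcs by (simp add: symmetric_def)
  show "irrefl (parcs G)" using pair_no_loops by (force simp: irrefl_def)
  show "u \<in> pverts G" "v \<in> pverts G" if "(u, v) \<in> parcs G"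
    using that by (rule in_arcsD1 in_arcsD2)+
qed

lemma unique_color_iff_card: "unique_color c N i \<longleftrightarrow> card {y \<in> N. c y = i} = 1"
proof -
  have "card {y \<in> N. c y = i} = 1 \<longleftrightarrow> (\<exists>y. {z \<in> N. c z = i} = {y})"
    unfolding One_nat_def by (rule card_1_singleton_iff)
  then show ?thesis unfolding unique_color_def by blast
qed

text \<open>The library describes walks by their arcs; this turns a vertex list into such a walk, so
  that vertex cycles enter the infimum in \<open>girth\<close>.\<close>

lemma zip_tl_walk:
  "q \<noteq> [] \<Longrightarrow> pcas (hd q) (zip q (tl q)) (last q)"
  "q \<noteq> [] \<Longrightarrow> pawalk_verts (hd q) (zip q (tl q)) = q"
  "set (zip q (tl q)) \<subseteq> darts q"
  by (induction q rule: darts.induct) auto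

lemma girth_le_cycle_length:
  assumes "pair_graph G" "distinct vs" "3 \<le> length vs" "closed_darts vs \<subseteq> parcs G"
  shows "girth G \<le> enat (length vs)"
proof -
  interpret pair_graph G by fact
  obtain u us where vs: "vs = u # us" "us \<noteq> []" using assms(3) by (cases vs; cases "tl vs") auto
  define q where "q = vs @ [hd vs]"
  define p where "p = zip q (tl q)"
  have q: "q \<noteq> []" "hd q = u" "last q = u" using vs by (auto simp: q_def)
  have len: "length p = length vs" using vs by (simp add: p_def q_def)
  have sub: "set p \<subseteq> parcs G" using zip_tl_walk(3)[of q] assms(4) by (auto simp: p_def q_def)
  have "pcas u p u" "pawalk_verts u p = q"
    using zip_tl_walk(1,2)[OF q(1)] q by (simp_all add: p_def)
  moreover have "u \<in> pverts G"
    using assms(4) vs by (cases us) (auto dest: in_arcsD1)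
  moreover have "distinct (tl q)" using assms(2) vs by (simp add: q_def)
  moreover have "p \<noteq> []" using len vs by auto
  ultimately have "cycle p"
    unfolding cycle_def awalk_def using sub by auto
  then have "girth G \<le> enat (length p)"
    unfolding girth_def using len assms(3) by (intro INF_lower) auto
  then show ?thesis using len by simp
qed

lemma pcf_chromatic_number_le:
  assumes "pair_graph G" "pcf_colorable (parcs G) k (pverts G)"
  shows "pcf_chromatic_number G \<le> k"
proof -
  obtain c where c: "pcf_on (parcs G) k (pverts G) c" using assms(2) unfolding pcf_colorable_def by blast
  have nb: "neighborhood G x = nbs (parcs G) (pverts G) x" for x
    using pair_graph_arcs(6)[OF assms(1)] by (auto simp: neighborhood_def nbs_def)
  have "c ` pverts G \<subseteq> {..<k}" using c unfolding pcf_on_def by auto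
  then have "card (c ` pverts G) \<le> k" using card_mono[of "{..<k}" "c ` pverts G"] by simp
  moreover have "proper_coloring G c"
    unfolding proper_coloring_def
  proof clarify
    fix u v assume uv: "(u, v) \<in> parcs G" "c u = c v"
    then have "u \<in> pverts G" "v \<in> nbs (parcs G) (pverts G) u"
      using pair_graph_arcs(5,6)[OF assms(1)] by (auto simp: in_nbs)
    then show False using c uv(2) unfolding pcf_on_def by blast
  qed
  moreover have "conflict_free_coloring G c"
    using c unfolding conflict_free_coloring_def nb pcf_on_def unique_color_iff_card by (elim conjE)
  ultimately have "pcf_coloring G k c" unfolding pcf_coloring_def by blast
  then have "\<exists>c. pcf_coloring G k c" by blast
  then show ?thesis unfolding pcf_chromatic_number_def by (rule Least_le)
qed

text \<open>Strictness comes from the slack 2 g of \<open>edge_bound\<close> if W induces an edge,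
  and otherwise from W being nonempty.\<close>

lemma planar_sparse:
  assumes "pair_graph G" "planar G" "enat g \<le> girth G" "W \<noteq> {}" "finite W" "0 < g"
  shows "g * card (parcs G \<inter> W \<times> W) < 2 * card (parcs G \<inter> W \<times> W) + 2 * g * card W"
proof -
  note G = pair_graph_arcs[OF assms(1)]
  obtain pos \<gamma> where drawing: "plane_drawing G pos \<gamma>" using assms(2) unfolding planar_def by blast
  have verts: "fst ` parcs G \<subseteq> pverts G" using G(5) by auto
  have edge: "arc (\<gamma> {u, v})" "{pathstart (\<gamma> {u, v}), pathfinish (\<gamma> {u, v})} = {pos u, pos v}"
    "(path_image (\<gamma> {u, v}) - {pos u, pos v}) \<inter> pos ` pverts G = {}"
    "\<And>x y. (x, y) \<in> parcs G \<Longrightarrow> {x, y} \<noteq> {u, v} \<Longrightarrow>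
      (path_image (\<gamma> {u, v}) - {pos u, pos v}) \<inter> path_image (\<gamma> {x, y}) = {}"
    if "(u, v) \<in> parcs G" for u v
    using drawing that unfolding plane_drawing_def by blast+
  interpret plane: plane_graph "parcs G" pos \<gamma>
  proof
    show "finite (parcs G)" "sym (parcs G)" "irrefl (parcs G)" by (rule G)+
    show "inj_on pos (fst ` parcs G)"
      using drawing inj_on_subset[OF _ verts] unfolding plane_drawing_def by blast
    show "(path_image (\<gamma> {u, v}) - {pos u, pos v}) \<inter> pos ` fst ` parcs G = {}" if "(u, v) \<in> parcs G" for u v
      using edge(3)[OF that] verts by blast
  qed (use edge in auto)
  let ?F = "parcs G \<inter> W \<times> W"
  show ?thesis
  proof (cases "?F = {}")
    case True
    then show ?thesis using assms(4-6) by (auto simp: card_gt_0_iff)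
  next
    case False
    have "sym ?F" using plane.sym_E unfolding sym_def by blast
    moreover have "g \<le> length vs" if vs: "distinct vs" "3 \<le> length vs" "closed_darts vs \<subseteq> parcs G" for vs
      using order_trans[OF assms(3) girth_le_cycle_length[OF assms(1) vs]] by simp
    ultimately have "g * card ?F + 2 * g \<le> 2 * card ?F + 2 * g * card (fst ` ?F)"
      using plane.edge_bound[of ?F g] False by blast
    moreover have "card (fst ` ?F) \<le> card W" using assms(5) by (intro card_mono) auto
    then have "2 * g * card (fst ` ?F) \<le> 2 * g * card W" by simp
    ultimately show ?thesis using assms(6) by linarith
  qed
qed

theorem theorem5p2:
  fixes G :: "'a pair_pre_digraph"
  assumes "pair_graph G" and "planar G"
  shows "(girth G \<ge> 7 \<longrightarrow> pcf_chromatic_number G \<le> 6) \<and>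
         (girth G \<ge> 10 \<longrightarrow> pcf_chromatic_number G \<le> 5) \<and>
         (girth G \<ge> 24 \<longrightarrow> pcf_chromatic_number G \<le> 4)"
proof (cases "girth G \<ge> 7")
  case True
  note G = pair_graph_arcs[OF assms(1)]
  have cycle_length: "7 \<le> length vs" if "distinct vs" "3 \<le> length vs" "closed_darts vs \<subseteq> parcs G" for vs
  proof -
    have "enat 7 \<le> enat (length vs)"
      using order_trans[OF True girth_le_cycle_length[OF assms(1) that]] by (simp add: numeral_eq_enat)
    then show ?thesis by simp
  qed
  have symG: "(b, a) \<in> parcs G" if "(a, b) \<in> parcs G" for a b
    using G(3) that by (rule symD)
  have neq: "a \<noteq> b" if "(a, b) \<in> parcs G" for a b using G(4) that by (auto simp: irrefl_def)
  interpret sparse: sparse_graph "parcs G"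
  proof
    show "sym (parcs G)" by (rule G)
    show "irrefl (parcs G)" by (rule G)
    show "(a, c) \<notin> parcs G" if "(a, b) \<in> parcs G" "(b, c) \<in> parcs G" for a b c
      using cycle_length[of "[a, b, c]"] that neq symG by auto
    show "a = c \<or> b = d"
      if "(a, b) \<in> parcs G" "(b, c) \<in> parcs G" "(c, d) \<in> parcs G" "(d, a) \<in> parcs G" for a b c d
      using cycle_length[of "[a, b, c, d]"] that neq symG by auto
  qed
  have no_5cycle: "(e, a) \<notin> parcs G"
    if edges: "(a, b) \<in> parcs G" "(b, c) \<in> parcs G" "(c, d) \<in> parcs G" "(d, e) \<in> parcs G" for a b c d e
  proof
    assume ea: "(e, a) \<in> parcs G"
    \<comment> \<open>A closed walk of five edges that repeats a vertex would contain a
      triangle.\<close>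
    have "a \<noteq> c" "b \<noteq> d" "c \<noteq> e" "d \<noteq> a" "e \<noteq> b"
      using edges ea sparse.no_triangle symG by blast+
    then have "distinct [a, b, c, d, e]" using edges ea neq by auto
    then show False using cycle_length[of "[a, b, c, d, e]"] edges ea symG by auto
  qed
  have colorable: "pcf_chromatic_number G \<le> k"
    if "\<And>W. W \<subseteq> pverts G \<Longrightarrow> W \<noteq> {} \<Longrightarrow> finite W \<Longrightarrow> \<not> sparse.critical k W" for k
    using that finite_subset[OF _ G(1)]
    by (intro pcf_chromatic_number_le[OF assms(1)] sparse.colorable_if_no_critical G(1)) blast
  note sparse_bound = planar_sparse[OF assms]
  have "pcf_chromatic_number G \<le> 6"
  proof (rule colorable)
    fix W :: "'a set" assume "W \<noteq> {}" "finite W"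
    then have "7 * card (parcs G \<inter> W \<times> W) < 2 * card (parcs G \<inter> W \<times> W) + 2 * 7 * card W"
      using sparse_bound[of 7 W] True by (simp add: numeral_eq_enat)
    then show "\<not> sparse.critical 6 W" using sparse.critical_6_dense[of W] by linarith
  qed
  moreover have "pcf_chromatic_number G \<le> 5" if "girth G \<ge> 10"
  proof (rule colorable)
    fix W :: "'a set" assume "W \<noteq> {}" "finite W"
    then have "10 * card (parcs G \<inter> W \<times> W) < 2 * card (parcs G \<inter> W \<times> W) + 2 * 10 * card W"
      using sparse_bound[of 10 W] that by (simp add: numeral_eq_enat)
    then show "\<not> sparse.critical 5 W" using sparse.critical_5_dense[of W] by linarith
  qed
  moreover have "pcf_chromatic_number G \<le> 4" if "girth G \<ge> 24"
  proof (rule colorable)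
    fix W :: "'a set" assume "W \<noteq> {}" "finite W"
    then have "24 * card (parcs G \<inter> W \<times> W) < 2 * card (parcs G \<inter> W \<times> W) + 2 * 24 * card W"
      using sparse_bound[of 24 W] that by (simp add: numeral_eq_enat)
    moreover have "24 * card W \<le> 11 * card (parcs G \<inter> W \<times> W)" if "sparse.critical 4 W"
      by (rule sparse.critical_4_dense[OF that]) (rule no_5cycle)
    ultimately show "\<not> sparse.critical 4 W" by linarith
  qed
  ultimately show ?thesis by blast
next
  case False
  \<comment> \<open>Below girth 7 the premises of all three claims fail.\<close>
  moreover have "(7 :: enat) \<le> 10" "(7 :: enat) \<le> 24" by simp_all
  ultimately show ?thesis by (meson order_trans)
qed

end
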